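(* Let $P$ be a connected infinite $\Gamma$-colored poset. Then $P$ is a $\Gamma$-colored $d$-complete poset if and only if it is a filter of some connected full heap.
   Context: Setup. $\Gamma$ is a finite set, whose elements are called colors, with fixed integers $\theta_{ab}$ ($a,b\in\Gamma$) such that $\theta_{aa}=2$; $\theta_{ab}\le 0$ for $a\ne b$; and $\theta_{ab}=0$ iff $\theta_{ba}=0$ (a Dynkin diagram). Distinct $a,b$ are adjacent ($a\sim b$) if $\theta_{ab}<0$. All posets are locally finite (all intervals are finite). $x,y$ are neighbors if one covers the other. A $\Gamma$-colored poset is a locally finite poset $P$ with a surjective map $\kappa:P\to\Gamma$; $P_a:=\kappa^{-1}(a)$. Elements $x<y$ are consecutive elements of the color $a$ if $x,y\in P_a$ and the open interval $(x,y)$ contains no element of color $a$. $U(x,P):=\{y\in P : y>x,\ \kappa(y)\sim\kappa(x)\}$. A poset is connected if it is not the disjoint union (with no relations between the parts) of two or more nonempty subposets. A $\Gamma$-colored poset is $\Gamma$-colored $d$-complete if: (EC) elements with equal colors are comparable; (NA) neighbors have adjacent colors; (AC) elements with adjacent colors are comparable; (ICE2) for every $a\in\Gamma$, if $x<y$ are consecutive elements of the color $a$, then $\sum_{z\in(x,y)}-\theta_{\kappa(z),a}=2$; (UCB1) for every $a\in\Gamma$, if $x$ is maximal in $P_a$, then $U(x,P)$ is finite and $\sum_{y\in U(x,P)}-\theta_{\kappa(y),a}\le 1$. A full heap is a locally finite $\Gamma$-colored poset such that: (G1) for every $a\in\Gamma$ and every pair of adjacent colors $b,c$, the subsets $P_a$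 and $P_b\cup P_c$ are chains; (G2) the partial order on $P$ is the minimal partial order extending the given order on these chains; (G3) for every $a$, $P_a$ is isomorphic as a poset to $\mathbb{Z}$; (G4) if $a\sim b$ and $x\in P_a$, then $x$ has a neighbor in $P_b$; (G5) for every $a$, if $x<y$ are consecutive elements of the color $a$, then $\sum_{z\in[x,y]}\theta_{\kappa(z),a}=2$. "$P$ is a filter of a full heap $Q$" means that $Q$ is a full heap colored by the same Dynkin diagram $\Gamma$, $P$ is an up-closed subset of $Q$, and the order and coloring of $P$ are the restrictions of those of $Q$. *)

theory Defs
  imports Main
begin

locale dynkin_diagram =
  fixes \<Gamma> :: "'c set" and \<theta> :: "'c \<Rightarrow> 'c \<Rightarrow> int"
  assumes finite_colors: "finite \<Gamma>"
    and theta_diag: "a \<in> \<Gamma> \<Longrightarrow> \<theta> a a = 2"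
    and theta_nonpos: "\<lbrakk>a \<in> \<Gamma>; b \<in> \<Gamma>; a \<noteq> b\<rbrakk> \<Longrightarrow> \<theta> a b \<le> 0"
    and theta_zero_iff: "\<lbrakk>a \<in> \<Gamma>; b \<in> \<Gamma>\<rbrakk> \<Longrightarrow> \<theta> a b = 0 \<longleftrightarrow> \<theta> b a = 0"
begin

definition adj :: "'c \<Rightarrow> 'c \<Rightarrow> bool"
  where "adj a b \<longleftrightarrow> a \<in> \<Gamma> \<and> b \<in> \<Gamma> \<and> a \<noteq> b \<and> \<theta> a b < 0"

end

text \<open>Posets are given by a carrier \<open>P\<close> and a reflexive order relation \<open>r \<subseteq> P \<times> P\<close>;
  \<open>(x, y) \<in> r\<close> means \<open>x \<le> y\<close>.\<close>

definition closed_interval :: "'a rel \<Rightarrow> 'a \<Rightarrow> 'a \<Rightarrow> 'a set"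
  where "closed_interval r x y = {z. (x, z) \<in> r \<and> (z, y) \<in> r}"

definition open_interval :: "'a rel \<Rightarrow> 'a \<Rightarrow> 'a \<Rightarrow> 'a set"
  where "open_interval r x y = closed_interval r x y - {x, y}"

definition locally_finite_poset :: "'a set \<Rightarrow> 'a rel \<Rightarrow> bool"
  where "locally_finite_poset P r \<longleftrightarrow>
    partial_order_on P r \<and> (\<forall>x\<in>P. \<forall>y\<in>P. finite (closed_interval r x y))"

definition covers :: "'a rel \<Rightarrow> 'a \<Rightarrow> 'a \<Rightarrow> bool"
  where "covers r y x \<longleftrightarrow> (x, y) \<in> r \<and> x \<noteq> y \<and> open_interval r x y = {}"

definition neighbors :: "'a rel \<Rightarrow> 'a \<Rightarrow> 'a \<Rightarrow> bool"
  where "neighbors r x y \<longleftrightarrow> covers r x y \<or> covers r y x"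

definition comparable :: "'a rel \<Rightarrow> 'a \<Rightarrow> 'a \<Rightarrow> bool"
  where "comparable r x y \<longleftrightarrow> (x, y) \<in> r \<or> (y, x) \<in> r"

definition connected_poset :: "'a set \<Rightarrow> 'a rel \<Rightarrow> bool"
  where "connected_poset P r \<longleftrightarrow>
    \<not> (\<exists>A B. A \<noteq> {} \<and> B \<noteq> {} \<and> A \<inter> B = {} \<and> A \<union> B = P \<and>
         (\<forall>x\<in>A. \<forall>y\<in>B. \<not> comparable r x y))"

locale colored_poset = dynkin_diagram \<Gamma> \<theta>
  for \<Gamma> :: "'c set" and \<theta> :: "'c \<Rightarrow> 'c \<Rightarrow> int" +
  fixes P :: "'a set" and r :: "'a rel" and \<kappa> :: "'a \<Rightarrow> 'c"
  assumes locally_finite: "locally_finite_poset P r"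
    and surjective: "\<kappa> ` P = \<Gamma>"
begin

definition color_class :: "'c \<Rightarrow> 'a set"
  where "color_class a = {x \<in> P. \<kappa> x = a}"

definition consecutive :: "'c \<Rightarrow> 'a \<Rightarrow> 'a \<Rightarrow> bool"
  where "consecutive a x y \<longleftrightarrow>
    x \<in> color_class a \<and> y \<in> color_class a \<and> (x, y) \<in> r \<and> x \<noteq> y \<and>
    open_interval r x y \<inter> color_class a = {}"

definition upper_adjacent :: "'a \<Rightarrow> 'a set"
  where "upper_adjacent x = {y \<in> P. (x, y) \<in> r \<and> x \<noteq> y \<and> adj (\<kappa> y) (\<kappa> x)}"

definition maximal_in :: "'a set \<Rightarrow> 'a \<Rightarrow> bool"
  where "maximal_in S x \<longleftrightarrow> x \<in> S \<and> (\<forall>y\<in>S. (x, y) \<in> r \<longrightarrow> y = x)"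

definition defining_chains :: "'a set set"
  where "defining_chains =
    {color_class a | a. a \<in> \<Gamma>} \<union> {color_class b \<union> color_class c | b c. adj b c}"

end

locale colored_d_complete = colored_poset \<Gamma> \<theta> P r \<kappa>
  for \<Gamma> :: "'c set" and \<theta> :: "'c \<Rightarrow> 'c \<Rightarrow> int"
    and P :: "'a set" and r :: "'a rel" and \<kappa> :: "'a \<Rightarrow> 'c" +
  assumes EC: "\<lbrakk>x \<in> P; y \<in> P; \<kappa> x = \<kappa> y\<rbrakk> \<Longrightarrow> comparable r x y"
    and NA: "\<lbrakk>x \<in> P; y \<in> P; neighbors r x y\<rbrakk> \<Longrightarrow> adj (\<kappa> x) (\<kappa> y)"
    and AC: "\<lbrakk>x \<in> P; y \<in> P; adj (\<kappa> x) (\<kappa> y)\<rbrakk> \<Longrightarrow> comparable r x y"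
    and ICE2: "\<lbrakk>a \<in> \<Gamma>; consecutive a x y\<rbrakk> \<Longrightarrow>
      (\<Sum>z\<in>open_interval r x y. - \<theta> (\<kappa> z) a) = 2"
    and UCB1: "\<lbrakk>a \<in> \<Gamma>; maximal_in (color_class a) x\<rbrakk> \<Longrightarrow>
      finite (upper_adjacent x) \<and> (\<Sum>y\<in>upper_adjacent x. - \<theta> (\<kappa> y) a) \<le> 1"

text \<open>In \<open>G2\<close>, the minimal partial order extending the given order on the chains is
  rendered as the least one: any partial order on \<open>P\<close> that extends the chains contains
  \<open>r\<close>. (Among the partial orders below \<open>r\<close>, minimal and least coincide, since the
  reflexive transitive closure of the order on the chains is then itself a partial order.)\<close>

locale full_heap = colored_poset \<Gamma> \<theta> P r \<kappa>
  for \<Gamma> :: "'c set" and \<theta> :: "'c \<Rightarrow> 'c \<Rightarrow> int"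
    and P :: "'a set" and r :: "'a rel" and \<kappa> :: "'a \<Rightarrow> 'c" +
  assumes G1: "defining_chains \<subseteq> Chains r"
    and G2: "\<lbrakk>partial_order_on P s; \<And>C. C \<in> defining_chains \<Longrightarrow> Restr r C \<subseteq> s\<rbrakk> \<Longrightarrow> r \<subseteq> s"
    and G3: "a \<in> \<Gamma> \<Longrightarrow> \<exists>f :: int \<Rightarrow> 'a. bij_betw f UNIV (color_class a) \<and>
      (\<forall>i j. (f i, f j) \<in> r \<longleftrightarrow> i \<le> j)"
    and G4: "\<lbrakk>adj a b; x \<in> color_class a\<rbrakk> \<Longrightarrow> \<exists>y\<in>color_class b. neighbors r x y"
    and G5: "\<lbrakk>a \<in> \<Gamma>; consecutive a x y\<rbrakk> \<Longrightarrow>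
      (\<Sum>z\<in>closed_interval r x y. \<theta> (\<kappa> z) a) = 2"

definition poset_filter :: "'a set \<Rightarrow> 'a set \<Rightarrow> 'a rel \<Rightarrow> bool"
  where "poset_filter F Q s \<longleftrightarrow> F \<subseteq> Q \<and> (\<forall>x\<in>F. \<forall>y\<in>Q. (x, y) \<in> s \<longrightarrow> y \<in> F)"

definition colored_iso ::
    "('a \<Rightarrow> 'b) \<Rightarrow> 'a set \<Rightarrow> 'a rel \<Rightarrow> ('a \<Rightarrow> 'c) \<Rightarrow> 'b set \<Rightarrow> 'b rel \<Rightarrow> ('b \<Rightarrow> 'c) \<Rightarrow> bool"
  where "colored_iso f P r \<kappa> P' r' \<kappa>' \<longleftrightarrow> bij_betw f P P' \<and>
    (\<forall>x\<in>P. \<forall>y\<in>P. (x, y) \<in> r \<longleftrightarrow> (f x, f y) \<in> r') \<and> (\<forall>x\<in>P. \<kappa>' (f x) = \<kappa> x)"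

text \<open>The carrier of \<open>P\<close> may exhaust its type, so the ambient full heap \<open>Q\<close> lives in a
  type \<open>'q\<close> of its own and \<open>P\<close> is identified, by an isomorphism of colored posets, with a
  filter of \<open>Q\<close> carrying the restricted order and coloring. A full heap is countable
  (finitely many color classes, each a copy of the integers), so every infinite type
  \<open>'q\<close> has a copy of every full heap.\<close>

definition filter_of_connected_full_heap ::
    "'q itself \<Rightarrow> 'c set \<Rightarrow> ('c \<Rightarrow> 'c \<Rightarrow> int) \<Rightarrow> 'a set \<Rightarrow> 'a rel \<Rightarrow> ('a \<Rightarrow> 'c) \<Rightarrow> bool"
  where "filter_of_connected_full_heap (_ :: 'q itself) \<Gamma> \<theta> P r \<kappa> \<longleftrightarrow>
    (\<exists>(Q :: 'q set) s \<mu> F f.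
       full_heap \<Gamma> \<theta> Q s \<mu> \<and> connected_poset Q s \<and>
       poset_filter F Q s \<and> colored_iso f P r \<kappa> F (Restr s F) \<mu>)"

end

(* A filter of a full heap has no maximal element in any color class, and its intervals and
   covers are those of the heap, so one direction is immediate.

   Conversely, let P be d-complete. Each filter F of P has a weight, a vector indexed by colors,
   with entries in {-1,0,1} on the colors that occur below F. The entry -1 marks the colors of the
   minimal elements of F, and removing such an element changes the weight by a simple reflection;
   so the weight alone tells which sequences of colors can be removed from F. As there are finitely
   many weights, some weight recurs. If all color classes had maxima, the colors between
   two occurrences could be removed forever from a finite filter; hence no class has a maximum.
   Then a filter F is the upper half of the heap of a periodic bi-infinite word, which is a full
   heap Q, and by ICE2 each further element of P going downwards has its place in Q. *)

theory Submission
  imports Defs "HOL-Library.FuncSet" "HOL-Library.Nat_Bijection"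
begin

text \<open>A weight governs only what is removed from \<open>F\<close>, that is, the part of
  \<open>P\<close> going upwards. It does not tell whether an element of a given color exists just
  below \<open>F\<close>, and \<open>P\<close> may stop there. This is why words are built by
  removal, why their negative half comes from periodicity alone, and why the rest of
  \<open>P\<close> has to be fitted into it by a separate counting argument. The bounds on the
  entries come from the axioms. While color \<open>a\<close> occurs in \<open>F\<close>, its entry
  is -1 plus a part of an ICE2 sum, which is 2. Once no element of color \<open>a\<close> is left,
  UCB1 keeps the entry at 0 or 1, so it never calls for a further removal. The ICE2 bound needs an
  element of color \<open>a\<close> outside \<open>F\<close>; hence entries are compared only on a
  set \<open>C\<close> of such colors. When classes have no maximum, nonempty filters are infinite
  and no sum over all of \<open>F\<close> makes sense; hence the entry of a color is computed from
  its least element in \<open>F\<close>.\<close>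

lemma finite_has_minimal_rel:
  assumes "finite A" "A \<noteq> {}" "trans r" "antisym r"
  shows "\<exists>m\<in>A. \<forall>z\<in>A. (z, m) \<in> r \<longrightarrow> z = m"
  using assms(1,2)
proof (induction A rule: finite_ne_induct)
  case (singleton x)
  then show ?case by simp
next
  case (insert x A)
  then obtain m where m: "m \<in> A" "\<And>z. z \<in> A \<Longrightarrow> (z, m) \<in> r \<Longrightarrow> z = m" by blast
  show ?case
  proof (cases "(x, m) \<in> r")
    case True
    have "z = x" if "z \<in> insert x A" "(z, x) \<in> r" for z
    proof (cases "z = x")
      case False
      then have "z = m" using that m(2) transD[OF assms(3) that(2) True] by blast
      then show ?thesis using antisymD[OF assms(4)] that(2) True by blast
    qed
    then show ?thesis by blast
  next
    case False
    then show ?thesis using m by blast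
  qed
qed

context dynkin_diagram
begin

lemma adj_sym: "adj a b \<longleftrightarrow> adj b a"
  unfolding adj_def using theta_zero_iff theta_nonpos by (metis order_le_less)

lemma adj_irrefl [simp]: "\<not> adj a a"
  by (simp add: adj_def)

lemma adj_in: "adj a b \<Longrightarrow> a \<in> \<Gamma>" "adj a b \<Longrightarrow> b \<in> \<Gamma>"
  by (auto simp: adj_def)

lemma theta_adj: "adj a b \<Longrightarrow> \<theta> a b \<le> - 1"
  by (auto simp: adj_def)

lemma theta_nonadj: "\<lbrakk>a \<in> \<Gamma>; b \<in> \<Gamma>; a \<noteq> b; \<not> adj a b\<rbrakk> \<Longrightarrow> \<theta> a b = 0"
  using theta_nonpos unfolding adj_def by (meson order_le_less)

end

section \<open>Covers and intervals in locally finite posets\<close>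

context colored_poset
begin

lemma po: "partial_order_on P r"
  using locally_finite by (simp add: locally_finite_poset_def)

lemma le_refl: "x \<in> P \<Longrightarrow> (x, x) \<in> r"
  using partial_order_onD(1)[OF po] by (simp add: refl_on_def)

lemma le_trans: "(x, y) \<in> r \<Longrightarrow> (y, z) \<in> r \<Longrightarrow> (x, z) \<in> r"
  using partial_order_onD(2)[OF po] by (rule transD)

lemma le_antisym: "(x, y) \<in> r \<Longrightarrow> (y, x) \<in> r \<Longrightarrow> x = y"
  using partial_order_onD(3)[OF po] by (rule antisymD)

lemma le_in: "(x, y) \<in> r \<Longrightarrow> x \<in> P" "(x, y) \<in> r \<Longrightarrow> y \<in> P"
  using partial_order_onD(4)[OF po] by auto

lemma finite_interval: "finite (closed_interval r x y)"
proof (cases "x \<in> P \<and> y \<in> P")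
  case True
  then show ?thesis using locally_finite by (simp add: locally_finite_poset_def)
next
  case False
  then have "closed_interval r x y = {}" using le_in by (auto simp: closed_interval_def)
  then show ?thesis by simp
qed

lemma finite_open_interval: "finite (open_interval r x y)"
  by (simp add: open_interval_def finite_interval)

lemma ex_minimal:
  assumes "finite A" "A \<noteq> {}"
  obtains m where "m \<in> A" "\<And>z. z \<in> A \<Longrightarrow> (z, m) \<in> r \<Longrightarrow> z = m"
  using finite_has_minimal_rel[OF assms partial_order_onD(2,3)[OF po]] by blast

lemma ex_maximal:
  assumes "finite A" "A \<noteq> {}"
  obtains m where "m \<in> A" "\<And>z. z \<in> A \<Longrightarrow> (m, z) \<in> r \<Longrightarrow> z = m"
proof -
  have "trans (r\<inverse>)" "antisym (r\<inverse>)" using partial_order_onD(2,3)[OF po] by simp_all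
  from finite_has_minimal_rel[OF assms this] show thesis using that by auto
qed

lemma ex_cover_above:
  assumes "(x, y) \<in> r" "x \<noteq> y"
  obtains z where "covers r z x" "(z, y) \<in> r"
proof -
  let ?A = "closed_interval r x y - {x}"
  have "y \<in> ?A" using assms le_in le_refl by (auto simp: closed_interval_def)
  then obtain m where m: "m \<in> ?A" "\<And>z. z \<in> ?A \<Longrightarrow> (z, m) \<in> r \<Longrightarrow> z = m"
    using ex_minimal[of ?A] finite_interval by blast
  have "covers r m x"
  proof -
    have False if "w \<in> open_interval r x m" for w
    proof -
      have w: "(x, w) \<in> r" "(w, m) \<in> r" "w \<noteq> x" "w \<noteq> m"
        using that by (auto simp: open_interval_def closed_interval_def)
      have "w \<in> ?A" using w le_trans[OF w(2), of y] m(1) by (simp add: closed_interval_def)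
      then show False using m(2) w by blast
    qed
    then show ?thesis using m(1) by (auto simp: covers_def closed_interval_def)
  qed
  then show thesis using that m(1) by (auto simp: closed_interval_def)
qed

lemma ex_cover_below:
  assumes "(x, y) \<in> r" "x \<noteq> y"
  obtains z where "covers r y z" "(x, z) \<in> r"
proof -
  let ?A = "closed_interval r x y - {y}"
  have "x \<in> ?A" using assms le_in le_refl by (auto simp: closed_interval_def)
  then obtain m where m: "m \<in> ?A" "\<And>z. z \<in> ?A \<Longrightarrow> (m, z) \<in> r \<Longrightarrow> z = m"
    using ex_maximal[of ?A] finite_interval by blast
  have "covers r y m"
  proof -
    have False if "w \<in> open_interval r m y" for w
    proof -
      have w: "(m, w) \<in> r" "(w, y) \<in> r" "w \<noteq> m" "w \<noteq> y"
        using that by (auto simp: open_interval_def closed_interval_def)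
      have "w \<in> ?A" using w le_trans[OF _ w(1), of x] m(1) by (simp add: closed_interval_def)
      then show False using m(2) w by blast
    qed
    then show ?thesis using m(1) by (auto simp: covers_def closed_interval_def)
  qed
  then show thesis using that m(1) by (auto simp: closed_interval_def)
qed

text \<open>NA speaks of neighbors only; cover chains carry it over to all relations of the poset.
  The induction works because an interval shrinks strictly when its bottom is replaced by a cover of
  it.\<close>

lemma le_imp_cover_chain: "(x, y) \<in> r \<Longrightarrow> (x, y) \<in> {(u, v). covers r v u}\<^sup>*"
proof (induction "card (closed_interval r x y)" arbitrary: x rule: less_induct)
  case less
  show ?case
  proof (cases "x = y")
    case False
    then obtain z where z: "covers r z x" "(z, y) \<in> r"
      using ex_cover_above less.prems by blast
    have xz: "(x, z) \<in> r" "x \<noteq> z" using z(1) by (auto simp: covers_def)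
    have "closed_interval r z y \<subset> closed_interval r x y"
    proof
      show "closed_interval r z y \<subseteq> closed_interval r x y"
        using le_trans[OF xz(1)] by (auto simp: closed_interval_def)
      have "x \<in> closed_interval r x y" "x \<notin> closed_interval r z y"
        using less.prems xz le_refl le_in le_antisym by (auto simp: closed_interval_def)
      then show "closed_interval r z y \<noteq> closed_interval r x y" by blast
    qed
    then have "card (closed_interval r z y) < card (closed_interval r x y)"
      by (intro psubset_card_mono finite_interval)
    from less.hyps[OF this z(2)] z(1) show ?thesis
      by (auto intro: converse_rtrancl_into_rtrancl)
  qed simp
qed

lemma color_in: "x \<in> P \<Longrightarrow> \<kappa> x \<in> \<Gamma>"
  using surjective by blast

lemma color_class_nonempty: "a \<in> \<Gamma> \<Longrightarrow> color_class a \<noteq> {}"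
  using surjective by (auto simp: color_class_def)

end

section \<open>Filters of full heaps are d-complete\<close>

context full_heap
begin

lemma same_color_comparable:
  assumes "x \<in> P" "y \<in> P" "\<kappa> x = \<kappa> y"
  shows "comparable r x y"
proof -
  have "color_class (\<kappa> x) \<in> Chains r"
    using G1 color_in[OF assms(1)] by (auto simp: defining_chains_def)
  then show ?thesis using assms by (auto simp: Chains_def color_class_def comparable_def)
qed

lemma adj_comparable:
  assumes "x \<in> P" "y \<in> P" "adj (\<kappa> x) (\<kappa> y)"
  shows "comparable r x y"
proof -
  have "color_class (\<kappa> x) \<union> color_class (\<kappa> y) \<in> Chains r"
    using G1 assms(3) unfolding defining_chains_def by blast
  then show ?thesis using assms by (auto simp: Chains_def color_class_def comparable_def)
qed

text \<open>Deleting a covering pair from a partial order leaves a partial order, so by the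
  minimality of the order each covering pair lies in a defining chain.\<close>

lemma cover_in_chain:
  assumes "covers r y x"
  shows "\<exists>C\<in>defining_chains. x \<in> C \<and> y \<in> C"
proof (rule ccontr)
  assume no: "\<not> ?thesis"
  have xy: "(x, y) \<in> r" "x \<noteq> y" "\<And>z. (x, z) \<in> r \<Longrightarrow> (z, y) \<in> r \<Longrightarrow> z = x \<or> z = y"
    using assms by (auto simp: covers_def open_interval_def closed_interval_def)
  have "trans (r - {(x, y)})"
  proof (rule transI)
    fix u v w assume "(u, v) \<in> r - {(x, y)}" "(v, w) \<in> r - {(x, y)}"
    then show "(u, w) \<in> r - {(x, y)}" using xy(3)[of v] le_trans[of u v w] by auto
  qed
  moreover have "antisym (r - {(x, y)})" using le_antisym by (auto intro: antisymI)
  ultimately have "partial_order_on P (r - {(x, y)})"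
    using le_refl le_in xy(2)
    by (auto simp: partial_order_on_def preorder_on_def refl_on_def)
  moreover have "Restr r C \<subseteq> r - {(x, y)}" if "C \<in> defining_chains" for C
    using no that by blast
  ultimately have "r \<subseteq> r - {(x, y)}" by (rule G2)
  then show False using xy by blast
qed

text \<open>G5 is ICE2 in another form: the endpoints contribute \<open>2 * \<theta> a a = 4\<close>
  to the closed sum 2, so the open interval contributes -2.\<close>

lemma open_interval_sum:
  assumes "a \<in> \<Gamma>" "consecutive a x y"
  shows "(\<Sum>z\<in>open_interval r x y. - \<theta> (\<kappa> z) a) = 2"
proof -
  have xy: "(x, y) \<in> r" "x \<noteq> y" "\<kappa> x = a" "\<kappa> y = a"
    using assms(2) by (auto simp: consecutive_def color_class_def)
  then have eq: "closed_interval r x y = insert x (insert y (open_interval r x y))"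
    using le_in le_refl by (auto simp: open_interval_def closed_interval_def)
  have "(\<Sum>z\<in>closed_interval r x y. \<theta> (\<kappa> z) a)
      = 4 + (\<Sum>z\<in>open_interval r x y. \<theta> (\<kappa> z) a)"
    unfolding eq using xy assms(1) finite_open_interval
    by (auto simp: theta_diag open_interval_def)
  with G5[OF assms] show ?thesis by (simp add: sum_negf)
qed

text \<open>A covering pair lies in a defining chain, so its colors are equal or adjacent. Equal
  colors would make the pair consecutive with an empty open interval, whose sum is 0 and not
  2.\<close>

lemma covers_adj:
  assumes "covers r y x"
  shows "adj (\<kappa> x) (\<kappa> y)"
proof -
  have xy: "(x, y) \<in> r" "x \<noteq> y" "open_interval r x y = {}" using assms by (auto simp: covers_def)
  have "\<kappa> x \<noteq> \<kappa> y"
  proof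
    assume eq: "\<kappa> x = \<kappa> y"
    have "consecutive (\<kappa> x) x y"
      using xy le_in eq by (auto simp: consecutive_def color_class_def)
    from open_interval_sum[OF _ this] xy(3) show False using color_in le_in xy(1) by auto
  qed
  moreover have "\<kappa> x = \<kappa> y \<or> adj (\<kappa> x) (\<kappa> y) \<or> adj (\<kappa> y) (\<kappa> x)"
    using cover_in_chain[OF assms] by (auto simp: defining_chains_def color_class_def)
  ultimately show ?thesis using adj_sym by blast
qed

end

lemma filter_of_full_heap_d_complete:
  assumes "colored_poset \<Gamma> \<theta> P r \<kappa>" "full_heap \<Gamma> \<theta> Q s \<mu>"
    "poset_filter F Q s" "colored_iso f P r \<kappa> F (Restr s F) \<mu>"
  shows "colored_d_complete \<Gamma> \<theta> P r \<kappa>"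
proof -
  interpret P: colored_poset \<Gamma> \<theta> P r \<kappa> by fact
  interpret Q: full_heap \<Gamma> \<theta> Q s \<mu> by fact
  have f: "bij_betw f P F" "\<And>x y. x \<in> P \<Longrightarrow> y \<in> P \<Longrightarrow> (x, y) \<in> r \<longleftrightarrow> (f x, f y) \<in> s"
    "\<And>x. x \<in> P \<Longrightarrow> \<mu> (f x) = \<kappa> x"
    using assms(4) by (auto simp: colored_iso_def bij_betw_def)
  have F: "F \<subseteq> Q" "\<And>x y. x \<in> F \<Longrightarrow> (x, y) \<in> s \<Longrightarrow> y \<in> F"
    using assms(3) Q.le_in by (auto simp: poset_filter_def)
  have inj: "inj_on f P" and im: "f ` P = F" using f(1) by (auto simp: bij_betw_def)
  have fQ: "f x \<in> Q" if "x \<in> P" for x using that im F(1) by blast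
  have cmp: "comparable r x y \<longleftrightarrow> comparable s (f x) (f y)" if "x \<in> P" "y \<in> P" for x y
    using f(2) that by (simp add: comparable_def)
  have ci: "closed_interval s (f x) (f y) = f ` closed_interval r x y" if "x \<in> P" "y \<in> P" for x y
  proof
    show "closed_interval s (f x) (f y) \<subseteq> f ` closed_interval r x y"
    proof
      fix z assume "z \<in> closed_interval s (f x) (f y)"
      then have z: "(f x, z) \<in> s" "(z, f y) \<in> s" by (auto simp: closed_interval_def)
      have "z \<in> F" using F(2)[OF _ z(1)] im that by blast
      then obtain w where "w \<in> P" "z = f w" using im by blast
      then show "z \<in> f ` closed_interval r x y" using z f(2)[of x w] f(2)[of w y] that
        by (auto simp: closed_interval_def)
    qed
    show "f ` closed_interval r x y \<subseteq> closed_interval s (f x) (f y)"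
    proof safe
      fix z assume "z \<in> closed_interval r x y"
      then have z: "(x, z) \<in> r" "(z, y) \<in> r" by (auto simp: closed_interval_def)
      have "z \<in> P" using z P.le_in by blast
      then show "f z \<in> closed_interval s (f x) (f y)"
        using f(2)[of x z] f(2)[of z y] z that by (simp add: closed_interval_def)
    qed
  qed
  have oi: "open_interval s (f x) (f y) = f ` open_interval r x y" if "x \<in> P" "y \<in> P" for x y
  proof -
    have "closed_interval r x y \<subseteq> P" using P.le_in by (auto simp: closed_interval_def)
    then have "f ` (closed_interval r x y - {x, y}) = f ` closed_interval r x y - f ` {x, y}"
      using inj that by (intro inj_on_image_set_diff) auto
    then show ?thesis using ci that by (simp add: open_interval_def)
  qed
  have cov: "covers r y x \<Longrightarrow> covers s (f y) (f x)" if "x \<in> P" "y \<in> P" for x y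
    using oi[OF that] f(2)[OF that] inj_on_eq_iff[OF inj that] unfolding covers_def by simp
  have cons: "Q.consecutive a (f x) (f y)" if "P.consecutive a x y" for a x y
  proof -
    have xy: "x \<in> P" "y \<in> P" using that by (auto simp: P.consecutive_def P.color_class_def)
    have "f z \<notin> Q.color_class a" if "z \<in> open_interval r x y" for z
    proof -
      have "z \<in> P" using that P.le_in by (auto simp: open_interval_def closed_interval_def)
      then show ?thesis using \<open>P.consecutive a x y\<close> that f(3)
        by (auto simp: P.consecutive_def P.color_class_def Q.color_class_def)
    qed
    then have "open_interval s (f x) (f y) \<inter> Q.color_class a = {}" using oi[OF xy] by auto
    moreover have "f x \<in> Q.color_class a" "f y \<in> Q.color_class a"
      using that xy f(3) F(1) im by (auto simp: P.consecutive_def P.color_class_def Q.color_class_def)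
    moreover have "(f x, f y) \<in> s" "f x \<noteq> f y"
      using that f(2)[OF xy] inj_on_eq_iff[OF inj xy] by (auto simp: P.consecutive_def)
    ultimately show ?thesis by (simp add: Q.consecutive_def)
  qed
  show ?thesis
  proof unfold_locales
    fix x y assume "x \<in> P" "y \<in> P" "\<kappa> x = \<kappa> y"
    then show "comparable r x y"
      using cmp Q.same_color_comparable[OF fQ fQ, of x y] f(3) by simp
  next
    fix x y assume xy: "x \<in> P" "y \<in> P" and "neighbors r x y"
    then consider "covers s (f x) (f y)" | "covers s (f y) (f x)"
      using cov by (auto simp: neighbors_def)
    then show "P.adj (\<kappa> x) (\<kappa> y)"
      by cases (use Q.covers_adj P.adj_sym f(3) xy in metis)+
  next
    fix x y assume "x \<in> P" "y \<in> P" "P.adj (\<kappa> x) (\<kappa> y)"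
    then show "comparable r x y"
      using cmp Q.adj_comparable[OF fQ fQ, of x y] f(3) by simp
  next
    fix a x y assume a: "a \<in> \<Gamma>" and c: "P.consecutive a x y"
    have xy: "x \<in> P" "y \<in> P" using c by (auto simp: P.consecutive_def P.color_class_def)
    have sub: "open_interval r x y \<subseteq> P"
      using P.le_in by (auto simp: open_interval_def closed_interval_def)
    have "(\<Sum>z\<in>open_interval r x y. - \<theta> (\<kappa> z) a) = (\<Sum>z\<in>open_interval r x y. - \<theta> (\<mu> (f z)) a)"
      using sub f(3) by (intro sum.cong) auto
    also have "\<dots> = (\<Sum>z\<in>open_interval s (f x) (f y). - \<theta> (\<mu> z) a)"
      unfolding oi[OF xy] using inj sub
      by (subst sum.reindex) (auto intro: inj_on_subset)
    finally show "(\<Sum>z\<in>open_interval r x y. - \<theta> (\<kappa> z) a) = 2"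
      using Q.open_interval_sum[OF a cons[OF c]] by simp
  next
    fix a x assume a: "a \<in> \<Gamma>" and x: "P.maximal_in (P.color_class a) x"
    obtain g :: "int \<Rightarrow> _" where g: "bij_betw g UNIV (Q.color_class a)"
      "\<And>i j. (g i, g j) \<in> s \<longleftrightarrow> i \<le> j" using Q.G3[OF a] by blast
    have xP: "x \<in> P" "\<kappa> x = a" using x by (auto simp: P.maximal_in_def P.color_class_def)
    then have "f x \<in> Q.color_class a" using f(3)[of x] F(1) im by (auto simp: Q.color_class_def)
    then obtain i where i: "f x = g i" using g(1) by (auto simp: bij_betw_def)
    \<comment> \<open>G3 supplies the next element of color \<open>a\<close>, and up-closedness puts
      it into the filter; so \<open>x\<close> is not maximal and UCB1 holds vacuously.\<close>
    have le: "(f x, g (i + 1)) \<in> s" using g(2) i by simp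
    then have "g (i + 1) \<in> F" using F(2) im xP by blast
    then obtain y where y: "y \<in> P" "f y = g (i + 1)" using im by (metis imageE)
    have "\<mu> (f y) = a" using y g(1) by (auto simp: bij_betw_def Q.color_class_def)
    then have "y \<in> P.color_class a" using y(1) f(3)[OF y(1)] by (simp add: P.color_class_def)
    moreover have "(x, y) \<in> r" using f(2) xP y le by simp
    ultimately have "y = x" using x by (auto simp: P.maximal_in_def)
    then have "g i = g (i + 1)" using y i by simp
    then have False using bij_betw_imp_inj_on[OF g(1)] injD[of g i "i + 1"] by simp
    then show "finite (P.upper_adjacent x) \<and> (\<Sum>y\<in>P.upper_adjacent x. - \<theta> (\<kappa> y) a) \<le> 1" ..
  qed
qed

section \<open>Heaps of bi-infinite words\<close>

lemma ex_pred_int: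
  fixes i j :: int
  assumes "R j" "j < i"
  obtains p where "R p" "p < i" "\<And>k. p < k \<Longrightarrow> k < i \<Longrightarrow> \<not> R k"
proof -
  let ?A = "{k. R k \<and> j \<le> k \<and> k < i}"
  have fin: "finite ?A" by (rule finite_subset[of _ "{j..<i}"]) auto
  have "j \<in> ?A" using assms by simp
  then have "Max ?A \<in> ?A" "j \<le> Max ?A" using Max_in[OF fin] Max_ge[OF fin] by blast+
  moreover have "\<not> R k" if "Max ?A < k" "k < i" for k
  proof
    assume "R k"
    then have "k \<in> ?A" using that \<open>j \<le> Max ?A\<close> by simp
    then show False using Max_ge[OF fin, of k] that by linarith
  qed
  ultimately show thesis using that by blast
qed

lemma ex_succ_int:
  fixes i j :: int
  assumes "R j" "i < j"
  obtains p where "R p" "i < p" "\<And>k. i < k \<Longrightarrow> k < p \<Longrightarrow> \<not> R k"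
proof -
  obtain q where q: "R (- q)" "q < - i" "\<And>k. q < k \<Longrightarrow> k < - i \<Longrightarrow> \<not> R (- k)"
    using ex_pred_int[of "\<lambda>k. R (- k)" "- j" "- i"] assms by auto
  have "\<not> R k" if "i < k" "k < - q" for k using q(3)[of "- k"] that by simp
  then show thesis using q that[of "- q"] by simp
qed

text \<open>Serves G3: the occurrences of a letter form such a set \<open>S\<close>. The enumeration
  iterates successor and predecessor in \<open>S\<close> from one element.\<close>

lemma int_subset_enumeration:
  fixes S :: "int set"
  assumes below: "\<And>i. \<exists>j<i. j \<in> S" and above: "\<And>i. \<exists>j>i. j \<in> S"
  obtains f :: "int \<Rightarrow> int" where "strict_mono f" "range f = S"
proof -
  have "\<exists>p. p \<in> S \<and> i < p \<and> (\<forall>k. i < k \<and> k < p \<longrightarrow> k \<notin> S)" for i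
    using ex_succ_int[of "\<lambda>k. k \<in> S" _ i] above by metis
  then obtain nx where nx: "\<And>i. nx i \<in> S" "\<And>i. i < nx i" "\<And>i k. i < k \<Longrightarrow> k < nx i \<Longrightarrow> k \<notin> S"
    by metis
  have "\<exists>p. p \<in> S \<and> p < i \<and> (\<forall>k. p < k \<and> k < i \<longrightarrow> k \<notin> S)" for i
    using ex_pred_int[of "\<lambda>k. k \<in> S" _ i] below by metis
  then obtain pr where pr: "\<And>i. pr i \<in> S" "\<And>i. pr i < i" "\<And>i k. pr i < k \<Longrightarrow> k < i \<Longrightarrow> k \<notin> S"
    by metis
  have nxpr: "nx (pr i) = i" if "i \<in> S" for i
    by (metis nx pr that linorder_cases)
  define i0 where "i0 = nx 0"
  define f where "f n = (if n \<ge> 0 then (nx ^^ nat n) i0 else (pr ^^ nat (- n)) i0)" for n :: int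
  have fS: "f n \<in> S" for n
  proof -
    have "(nx ^^ k) i0 \<in> S" for k by (cases k) (auto simp: i0_def nx(1))
    moreover have "(pr ^^ k) i0 \<in> S" for k by (cases k) (auto simp: i0_def nx(1) pr(1))
    ultimately show ?thesis by (simp add: f_def)
  qed
  have step: "f (n + 1) = nx (f n)" for n
  proof (cases "n \<ge> 0")
    case True
    then have "nat (n + 1) = Suc (nat n)" by simp
    then show ?thesis using True by (simp add: f_def)
  next
    case False
    then have "nat (- n) = Suc (nat (- (n + 1)))" by simp
    then have "f n = pr ((pr ^^ nat (- (n + 1))) i0)" using False by (simp add: f_def)
    also have "(pr ^^ nat (- (n + 1))) i0 = f (n + 1)"
      using False by (cases "n = - 1") (auto simp: f_def)
    finally show ?thesis using nxpr[OF fS] by simp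
  qed
  \<comment> \<open>The values are integers, so each step gains at least 1; this gives strict
    monotonicity and unboundedness in both directions.\<close>
  have inc: "f m + (n - m) \<le> f n" if "m \<le> n" for m n
    using that
  proof (induction n rule: int_ge_induct)
    case (step n)
    then show ?case using nx(2)[of "f n"] \<open>f (n + 1) = nx (f n)\<close> by linarith
  qed simp
  have "strict_mono f"
  proof (rule strict_monoI)
    fix m n :: int assume "m < n"
    then show "f m < f n" using inc[of m n] by simp
  qed
  moreover have "range f = S"
  proof
    show "S \<subseteq> range f"
    proof
      fix j assume j: "j \<in> S"
      \<comment> \<open>By \<open>inc\<close>, \<open>f\<close> is at most \<open>j\<close> at this
        index and exceeds \<open>j\<close> at \<open>max 0 (j - f 0) + 1\<close>. Where
        \<open>f\<close> first passes \<open>j\<close>, the value before must be \<open>j\<close>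
        itself, as no element of \<open>S\<close> is skipped.\<close>
      let ?n0 = "min 0 (j - f 0)"
      have "f ?n0 \<le> j" using inc[of ?n0 0] by simp
      moreover have "\<not> f k \<le> j" if "k = max 0 (j - f 0) + 1" for k
        using inc[of 0 k] that by simp
      ultimately obtain p where p: "f (p - 1) \<le> j" "\<not> f p \<le> j"
      proof -
        let ?k = "max 0 (j - f 0) + 1"
        have "?n0 < ?k" by simp
        then obtain p where "\<not> f p \<le> j" "?n0 < p" "\<And>k. ?n0 < k \<Longrightarrow> k < p \<Longrightarrow> f k \<le> j"
          using ex_succ_int[of "\<lambda>k. \<not> f k \<le> j" ?k ?n0]
            \<open>\<And>k. k = max 0 (j - f 0) + 1 \<Longrightarrow> \<not> f k \<le> j\<close> by metis
        moreover have "f (p - 1) \<le> j"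
          using calculation \<open>f ?n0 \<le> j\<close> by (cases "p - 1 = ?n0") auto
        ultimately show thesis using that by blast
      qed
      have "f p = nx (f (p - 1))" using step[of "p - 1"] by simp
      then have "j = f (p - 1)" using nx(3)[of "f (p - 1)" j] j p by force
      then show "j \<in> range f" by blast
    qed
  qed (use fS in auto)
  ultimately show thesis using that by blast
qed

text \<open>The data from which a full heap is made. In \<open>gap_sum\<close> all positions between
  two occurrences count, whether or not they will be comparable to the ends: nonadjacent colors
  contribute 0.\<close>

locale heap_word = dynkin_diagram \<Gamma> \<theta>
  for \<Gamma> :: "'c set" and \<theta> :: "'c \<Rightarrow> 'c \<Rightarrow> int" +
  fixes c :: "int \<Rightarrow> 'c"
  assumes letter_in: "c i \<in> \<Gamma>"
    and letter_below: "a \<in> \<Gamma> \<Longrightarrow> \<exists>j<i. c j = a"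
    and letter_above: "a \<in> \<Gamma> \<Longrightarrow> \<exists>j>i. c j = a"
    and gap_sum: "\<lbrakk>i < j; c j = c i; \<And>k. i < k \<Longrightarrow> k < j \<Longrightarrow> c k \<noteq> c i\<rbrakk> \<Longrightarrow>
      (\<Sum>k\<in>{i<..<j}. - \<theta> (c k) (c i)) = 2"
begin

text \<open>The order generated by these steps is Viennot's heap of a word: letters commute unless
  they are equal or adjacent.\<close>

definition step_rel :: "int rel"
  where "step_rel = {(i, j). i \<le> j \<and> (c i = c j \<or> adj (c i) (c j))}"

definition heap_le :: "int rel"
  where "heap_le = step_rel\<^sup>*"

lemma heap_le_imp_le: "(i, j) \<in> heap_le \<Longrightarrow> i \<le> j"
  unfolding heap_le_def by (induction rule: rtrancl_induct) (auto simp: step_rel_def)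

lemma heap_le_step: "i \<le> j \<Longrightarrow> c i = c j \<or> adj (c i) (c j) \<Longrightarrow> (i, j) \<in> heap_le"
  by (auto simp: heap_le_def step_rel_def)

lemma heap_le_refl: "(i, i) \<in> heap_le"
  by (simp add: heap_le_def)

lemma heap_le_trans: "(i, j) \<in> heap_le \<Longrightarrow> (j, k) \<in> heap_le \<Longrightarrow> (i, k) \<in> heap_le"
  by (simp add: heap_le_def)

lemma heap_le_first_step:
  assumes "(i, j) \<in> heap_le" "i \<noteq> j"
  obtains k where "(i, k) \<in> step_rel" "k \<noteq> i" "(k, j) \<in> heap_le"
proof -
  have "(i, j) \<in> (step_rel - Id)\<^sup>*" using assms(1) by (simp add: heap_le_def rtrancl_r_diff_Id)
  then obtain k where k: "(i, k) \<in> step_rel - Id" "(k, j) \<in> (step_rel - Id)\<^sup>*"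
    using assms(2) by (blast elim: converse_rtranclE)
  then show thesis using that[of k] by (auto simp: heap_le_def rtrancl_r_diff_Id)
qed

lemma heap_le_last_step:
  assumes "(i, j) \<in> heap_le" "i \<noteq> j"
  obtains k where "(k, j) \<in> step_rel" "k \<noteq> j" "(i, k) \<in> heap_le"
proof -
  have "(i, j) \<in> (step_rel - Id)\<^sup>*" using assms(1) by (simp add: heap_le_def rtrancl_r_diff_Id)
  then obtain k where k: "(k, j) \<in> step_rel - Id" "(i, k) \<in> (step_rel - Id)\<^sup>*"
    using assms(2) by (blast elim: rtranclE)
  then show thesis using that[of k] by (auto simp: heap_le_def rtrancl_r_diff_Id)
qed

lemma gap_sum_adj:
  assumes "i < j" "c j = c i" "\<And>k. i < k \<Longrightarrow> k < j \<Longrightarrow> c k \<noteq> c i"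
  shows "(\<Sum>k\<in>{k. i < k \<and> k < j \<and> adj (c k) (c i)}. - \<theta> (c k) (c i)) = 2"
proof -
  have "(\<Sum>k\<in>{k. i < k \<and> k < j \<and> adj (c k) (c i)}. - \<theta> (c k) (c i))
      = (\<Sum>k\<in>{i<..<j}. - \<theta> (c k) (c i))"
    using assms(3) theta_nonadj[OF letter_in letter_in] by (intro sum.mono_neutral_left) auto
  then show ?thesis using gap_sum[OF assms] by simp
qed

text \<open>If \<open>i\<close> had no neighbor of color \<open>b\<close>, an element of a color adjacent to \<open>b\<close> would lie on
  either side of \<open>i\<close> between the surrounding elements of color \<open>b\<close>, and these three would
  contribute at least \<open>3\<close> to a sum equal to \<open>2\<close>.\<close>

lemma ex_neighbor_index:
  assumes "adj (c i) b"
  shows "\<exists>j. c j = b \<and>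
    ((j, i) \<in> heap_le \<and> (\<forall>k. (j, k) \<in> heap_le \<and> (k, i) \<in> heap_le \<longrightarrow> k = i \<or> k = j) \<or>
     (i, j) \<in> heap_le \<and> (\<forall>k. (i, k) \<in> heap_le \<and> (k, j) \<in> heap_le \<longrightarrow> k = i \<or> k = j))"
proof (rule ccontr)
  assume no: "\<not> ?thesis"
  have b: "b \<in> \<Gamma>" "c i \<noteq> b" using assms adj_in by auto
  obtain j where j: "c j = b" "j < i" "\<And>k. j < k \<Longrightarrow> k < i \<Longrightarrow> c k \<noteq> b"
    using ex_pred_int[of "\<lambda>k. c k = b" _ i] letter_below[OF b(1)] by metis
  obtain j' where j': "c j' = b" "i < j'" "\<And>k. i < k \<Longrightarrow> k < j' \<Longrightarrow> c k \<noteq> b"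
    using ex_succ_int[of "\<lambda>k. c k = b" _ i] letter_above[OF b(1)] by metis
  have ji: "(j, i) \<in> heap_le" "(i, j') \<in> heap_le"
    using j j' assms adj_sym by (auto intro!: heap_le_step)
  obtain k where k: "(j, k) \<in> heap_le" "(k, i) \<in> heap_le" "k \<noteq> i" "k \<noteq> j"
    using no j(1) ji(1) by blast
  obtain k' where k': "(i, k') \<in> heap_le" "(k', j') \<in> heap_le" "k' \<noteq> i" "k' \<noteq> j'"
    using no j'(1) ji(2) by blast
  \<comment> \<open>The first proper step up from \<open>j\<close> ends before \<open>i\<close>. As
    no letter \<open>b\<close> lies between \<open>j\<close> and \<open>j'\<close>, the letter at
    \<open>l\<close> is not \<open>b\<close>, hence adjacent to \<open>b\<close>. The same holds for
    \<open>l'\<close> on the other side.\<close>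
  obtain l where l: "(j, l) \<in> step_rel" "l \<noteq> j" "(l, k) \<in> heap_le"
    using heap_le_first_step[OF k(1)] k(4) by blast
  obtain l' where l': "(l', j') \<in> step_rel" "l' \<noteq> j'" "(k', l') \<in> heap_le"
    using heap_le_last_step[OF k'(2)] k'(4) by blast
  have "j \<le> l" "l' \<le> j'" using l(1) l'(1) by (auto simp: step_rel_def)
  then have ll: "j < l" "l < i" "i < l'" "l' < j'"
    using l(2) l'(2) k(3) k'(3) heap_le_imp_le[OF l(3)] heap_le_imp_le[OF l'(3)]
      heap_le_imp_le[OF k(2)] heap_le_imp_le[OF k'(1)] by linarith+
  have neq: "c k \<noteq> b" if "j < k" "k < j'" for k
    using that j(3)[of k] j'(3)[of k] b(2) by (cases k i rule: linorder_cases) auto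
  have "adj b (c l)" "adj (c l') b"
    using l(1) l'(1) j(1) j'(1) neq[of l] neq[of l'] ll by (auto simp: step_rel_def)
  then have adj: "adj (c l) b" "adj (c l') b" "adj (c i) b" using adj_sym assms by blast+
  have "(\<Sum>k\<in>{l, i, l'}. - \<theta> (c k) b) \<le> (\<Sum>k\<in>{k. j < k \<and> k < j' \<and> adj (c k) b}. - \<theta> (c k) b)"
    using ll adj theta_adj by (intro sum_mono2) (auto intro: finite_subset[of _ "{j..j'}"] simp: adj_def)
  also have "\<dots> = 2" using gap_sum_adj[of j j'] j j' neq by simp
  finally show False using ll theta_adj[OF adj(1)] theta_adj[OF adj(2)] theta_adj[OF adj(3)] by simp
qed

text \<open>Positions are integers, but the ambient heap has to live in a prescribed infinite type;
  an injection \<open>e\<close> carries the order there.\<close>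

definition heap_order :: "(int \<Rightarrow> 'q) \<Rightarrow> 'q rel"
  where "heap_order e = map_prod e e ` heap_le"

lemma heap_order_iff: "inj e \<Longrightarrow> (e i, e j) \<in> heap_order e \<longleftrightarrow> (i, j) \<in> heap_le"
  by (auto simp: heap_order_def inj_def)

lemma heap_closed_interval:
  assumes e: "inj e"
  shows "closed_interval (heap_order e) (e i) (e j)
    = e ` {k. (i, k) \<in> heap_le \<and> (k, j) \<in> heap_le}"
proof -
  have "z \<in> range e" if "(e i, z) \<in> heap_order e" for z using that by (auto simp: heap_order_def)
  then show ?thesis using heap_order_iff[OF e] by (fastforce simp: closed_interval_def)
qed

lemma colored_poset_heap:
  assumes e: "inj e"
  shows "colored_poset \<Gamma> \<theta> (range e) (heap_order e) (c \<circ> inv e)"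
proof unfold_locales
  have "trans (heap_order e)"
    using e by (auto intro!: transI simp: heap_order_def inj_eq dest: heap_le_trans)
  moreover have "antisym (heap_order e)"
    using e by (auto intro!: antisymI simp: heap_order_def inj_eq dest!: heap_le_imp_le)
  moreover have "heap_order e \<subseteq> range e \<times> range e" by (auto simp: heap_order_def)
  moreover have "refl_on (range e) (heap_order e)"
    using heap_le_refl by (auto simp: refl_on_def heap_order_iff[OF e])
  moreover have "finite (closed_interval (heap_order e) (e i) (e j))" for i j
  proof -
    have "{k. (i, k) \<in> heap_le \<and> (k, j) \<in> heap_le} \<subseteq> {i..j}" by (auto dest: heap_le_imp_le)
    then show ?thesis
      unfolding heap_closed_interval[OF e] by (intro finite_imageI) (rule finite_subset, auto)
  qed
  ultimately show "locally_finite_poset (range e) (heap_order e)"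
    by (auto simp: locally_finite_poset_def partial_order_on_def preorder_on_def)
  show "(c \<circ> inv e) ` range e = \<Gamma>"
  proof
    show "\<Gamma> \<subseteq> (c \<circ> inv e) ` range e"
    proof
      fix a assume "a \<in> \<Gamma>"
      then obtain j where "c j = a" using letter_below by blast
      then show "a \<in> (c \<circ> inv e) ` range e" using e by (auto simp: image_iff)
    qed
  qed (use letter_in e in auto)
qed

text \<open>G2 holds because the order is generated by \<open>step_rel\<close> and each step lies in
  a defining chain. G4 is \<open>ex_neighbor_index\<close>, and G5 is \<open>gap_sum\<close> with
  the two endpoints added.\<close>

lemma full_heap_word:
  assumes e: "inj e"
  shows "full_heap \<Gamma> \<theta> (range e) (heap_order e) (c \<circ> inv e)"
proof -
  interpret H: colored_poset \<Gamma> \<theta> "range e" "heap_order e" "c \<circ> inv e"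
    by (rule colored_poset_heap[OF e])
  have cc: "H.color_class a = e ` {i. c i = a}" for a
    using e by (auto simp: H.color_class_def)
  have chain: "e ` A \<in> Chains (heap_order e)"
    if "\<And>i j. i \<in> A \<Longrightarrow> j \<in> A \<Longrightarrow> c i = c j \<or> adj (c i) (c j)" for A
    unfolding Chains_def
  proof safe
    fix i j assume "i \<in> A" "j \<in> A" and n: "(e j, e i) \<notin> heap_order e"
    then have "(i, j) \<in> heap_le \<or> (j, i) \<in> heap_le"
      using that[of i j] that[of j i] by (cases "i \<le> j") (auto intro: heap_le_step)
    then show "(e i, e j) \<in> heap_order e" using n heap_order_iff[OF e] by simp
  qed
  show ?thesis
  proof unfold_locales
    show "H.defining_chains \<subseteq> Chains (heap_order e)"
    proof
      fix C assume "C \<in> H.defining_chains"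
      then consider a where "C = e ` {i. c i = a}"
        | a b where "C = e ` ({i. c i = a} \<union> {i. c i = b})" "adj a b"
        by (auto simp: H.defining_chains_def cc image_Un)
      then show "C \<in> Chains (heap_order e)"
        by cases (use adj_sym in \<open>auto intro!: chain\<close>)
    qed
  next
    fix s assume s: "partial_order_on (range e) s"
      "\<And>C. C \<in> H.defining_chains \<Longrightarrow> Restr (heap_order e) C \<subseteq> s"
    have chain_step: "(e i, e j) \<in> s" if "(i, j) \<in> step_rel" for i j
    proof -
      have "\<exists>C\<in>H.defining_chains. e i \<in> C \<and> e j \<in> C"
      proof (cases "c i = c j")
        case True
        then show ?thesis using letter_in[of i]
          by (intro bexI[of _ "H.color_class (c i)"]) (auto simp: H.defining_chains_def cc)
      next
        case False
        then have "adj (c i) (c j)" using that by (auto simp: step_rel_def)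
        then show ?thesis
          by (intro bexI[of _ "H.color_class (c i) \<union> H.color_class (c j)"])
            (auto simp: H.defining_chains_def cc)
      qed
      moreover have "(e i, e j) \<in> heap_order e"
        using that by (auto simp: heap_order_iff[OF e] heap_le_def)
      ultimately show ?thesis using s(2) by blast
    qed
    have "(e i, e j) \<in> s" if "(i, j) \<in> heap_le" for i j
      using that unfolding heap_le_def
    proof (induction rule: rtrancl_induct)
      case base
      then show ?case using partial_order_onD(1)[OF s(1)] by (simp add: refl_on_def)
    next
      case (step j k)
      then show ?case using chain_step partial_order_onD(2)[OF s(1)] by (blast dest: transD)
    qed
    then show "heap_order e \<subseteq> s" by (auto simp: heap_order_def)
  next
    fix a assume a: "a \<in> \<Gamma>"
    obtain f :: "int \<Rightarrow> int" where f: "strict_mono f" "range f = {i. c i = a}"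
      using int_subset_enumeration[of "{i. c i = a}"] letter_below[OF a] letter_above[OF a]
      by auto
    have "bij_betw (e \<circ> f) UNIV (H.color_class a)"
      unfolding bij_betw_def cc f(2)[symmetric]
      using e strict_mono_imp_inj_on[OF f(1)] by (auto simp: image_comp inj_compose)
    moreover have "((e \<circ> f) i, (e \<circ> f) j) \<in> heap_order e \<longleftrightarrow> i \<le> j" for i j
    proof -
      have "f k \<in> {i. c i = a}" for k unfolding f(2)[symmetric] by simp
      then have "c (f i) = c (f j)" by simp
      then have "(f i, f j) \<in> heap_le \<longleftrightarrow> f i \<le> f j"
        using heap_le_imp_le heap_le_step by blast
      then show ?thesis using heap_order_iff[OF e] strict_mono_less_eq[OF f(1)] by simp
    qed
    ultimately show "\<exists>f :: int \<Rightarrow> _. bij_betw f UNIV (H.color_class a) \<and>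
        (\<forall>i j. (f i, f j) \<in> heap_order e \<longleftrightarrow> i \<le> j)" by blast
  next
    fix a b x assume ab: "adj a b" and "x \<in> H.color_class a"
    then obtain i where i: "x = e i" "c i = a" by (auto simp: cc)
    have cov: "covers (heap_order e) (e k) (e j)"
      if "(j, k) \<in> heap_le" "j \<noteq> k" "\<forall>l. (j, l) \<in> heap_le \<and> (l, k) \<in> heap_le \<longrightarrow> l = j \<or> l = k"
      for j k
      using that e
      by (auto simp: covers_def open_interval_def heap_closed_interval heap_order_iff inj_eq)
    obtain j where j: "c j = b"
      "(j, i) \<in> heap_le \<and> (\<forall>k. (j, k) \<in> heap_le \<and> (k, i) \<in> heap_le \<longrightarrow> k = i \<or> k = j) \<or>
       (i, j) \<in> heap_le \<and> (\<forall>k. (i, k) \<in> heap_le \<and> (k, j) \<in> heap_le \<longrightarrow> k = i \<or> k = j)"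
      using ex_neighbor_index[of i b] ab i(2) by blast
    have "i \<noteq> j" using j(1) i(2) ab by auto
    then have "neighbors (heap_order e) x (e j)"
      using j(2) cov[of i j] cov[of j i] unfolding neighbors_def i(1) by blast
    then show "\<exists>y\<in>H.color_class b. neighbors (heap_order e) x y" using j(1) by (auto simp: cc)
  next
    fix a x y assume a: "a \<in> \<Gamma>" and cons: "H.consecutive a x y"
    then obtain i j where ij: "x = e i" "c i = a" "y = e j" "c j = a"
      by (auto simp: H.consecutive_def cc)
    have "(i, j) \<in> heap_le" "i \<noteq> j"
      using cons ij heap_order_iff[OF e] by (auto simp: H.consecutive_def)
    then have lt: "i < j" using heap_le_imp_le by force
    have no: "c k \<noteq> a" if "i < k" "k < j" for k
    proof
      assume k: "c k = a"
      then have "(i, k) \<in> heap_le" "(k, j) \<in> heap_le" using that ij by (auto intro!: heap_le_step)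
      then have "e k \<in> open_interval (heap_order e) x y"
        using that e ij by (auto simp: open_interval_def heap_closed_interval inj_eq)
      then show False using cons k by (auto simp: H.consecutive_def cc)
    qed
    let ?I = "{k. (i, k) \<in> heap_le \<and> (k, j) \<in> heap_le}"
    have "(\<Sum>z\<in>closed_interval (heap_order e) x y. \<theta> ((c \<circ> inv e) z) a) = (\<Sum>k\<in>?I. \<theta> (c k) a)"
      unfolding ij(1,3) heap_closed_interval[OF e] using e
      by (subst sum.reindex) (auto intro: inj_on_subset)
    \<comment> \<open>A position between \<open>i\<close> and \<open>j\<close> whose letter is
      \<open>a\<close> or adjacent to \<open>a\<close> is comparable to both ends, so the positions
      missing from the heap interval contribute 0.\<close>
    also have "\<dots> = (\<Sum>k\<in>{i..j}. \<theta> (c k) a)"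
    proof (rule sum.mono_neutral_left)
      show "\<forall>k\<in>{i..j} - ?I. \<theta> (c k) a = 0"
      proof
        fix k assume k: "k \<in> {i..j} - ?I"
        have "\<not> (c k = a \<or> adj (c k) a)"
          using k ij adj_sym[of "c k" a] heap_le_step[of i k] heap_le_step[of k j] by auto
        then show "\<theta> (c k) a = 0" using theta_nonadj letter_in a by blast
      qed
    qed (auto dest: heap_le_imp_le)
    also have "{i..j} = insert i (insert j {i<..<j})" using lt by auto
    also have "(\<Sum>k\<in>insert i (insert j {i<..<j}). \<theta> (c k) a)
        = 4 + (\<Sum>k\<in>{i<..<j}. \<theta> (c k) a)"
      using lt ij theta_diag[OF a] by simp
    also have "\<dots> = 2" using gap_sum[OF lt] no ij by (simp add: sum_negf)
    finally show "(\<Sum>z\<in>closed_interval (heap_order e) x y. \<theta> ((c \<circ> inv e) z) a) = 2" .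
  qed
qed

text \<open>\<open>conn\<close> says that the Dynkin diagram is connected. Positions with equal or
  adjacent letters are always comparable, so the letters of one part of a splitting are closed under
  adjacency and exhaust \<Gamma>, leaving none for the other part.\<close>

lemma connected_heap_word:
  assumes e: "inj e"
    and conn: "\<And>S. S \<subseteq> \<Gamma> \<Longrightarrow> S \<noteq> {} \<Longrightarrow> (\<And>a b. a \<in> S \<Longrightarrow> adj a b \<Longrightarrow> b \<in> S) \<Longrightarrow> S = \<Gamma>"
  shows "connected_poset (range e) (heap_order e)"
  unfolding connected_poset_def
proof (intro notI, elim exE conjE)
  fix A B assume A: "A \<noteq> {}" and B: "B \<noteq> {}" and AB: "A \<inter> B = {}" "A \<union> B = range e"
    and no: "\<forall>x\<in>A. \<forall>y\<in>B. \<not> comparable (heap_order e) x y"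
  have same: "e j \<in> A" if "e i \<in> A" "c i = c j \<or> adj (c i) (c j)" for i j
  proof -
    have "(i, j) \<in> heap_le \<or> (j, i) \<in> heap_le"
      using that(2) adj_sym[of "c i" "c j"] heap_le_step[of i j] heap_le_step[of j i] linear[of i j]
      by metis
    then have "comparable (heap_order e) (e i) (e j)"
      by (auto simp: comparable_def heap_order_iff[OF e])
    then show ?thesis using no that(1) AB(2) by blast
  qed
  let ?S = "{c i | i. e i \<in> A}"
  have "?S = \<Gamma>"
  proof (rule conn)
    show "?S \<subseteq> \<Gamma>" using letter_in by auto
    obtain x where x: "x \<in> A" using A by blast
    then have "x \<in> range e" using AB(2) by blast
    then show "?S \<noteq> {}" using x by blast
    show "b \<in> ?S" if ab: "a \<in> ?S" "adj a b" for a b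
    proof -
      obtain i where i: "e i \<in> A" "c i = a" using ab(1) by blast
      obtain j where j: "c j = b" using letter_below[OF adj_in(2)[OF ab(2)]] by blast
      then show ?thesis using same[OF i(1), of j] i(2) ab(2) by blast
    qed
  qed
  moreover obtain y where y: "y \<in> B" using B by blast
  moreover have "y \<in> range e" using y AB(2) by blast
  then obtain j where j: "y = e j" by blast
  ultimately obtain i where "e i \<in> A" "c j = c i" using letter_in[of j] by blast
  then have "y \<in> A" using same[of i j] j by simp
  with y AB(1) show False by blast
qed

end

section \<open>Weights of filters\<close>

context dynkin_diagram
begin

text \<open>As \<open>M k (c k) = - 1\<close>, the update is
  \<open>M k a - M k (c k) * \<theta> (c k) a\<close>: a simple reflection, or a move of the numbers
  game at a node of value -1.\<close>

definition weighted_word :: "'c set \<Rightarrow> (int \<Rightarrow> 'c) \<Rightarrow> (int \<Rightarrow> 'c \<Rightarrow> int) \<Rightarrow> bool"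
  where "weighted_word C c M \<longleftrightarrow> (\<forall>k. c k \<in> C \<and> M k (c k) = - 1 \<and>
    (\<forall>a\<in>C. M (k + 1) a = M k a + \<theta> (c k) a))"

text \<open>A closed loop of \<open>N\<close> weights is read modulo \<open>N\<close>, which defines
  the word at negative positions too, although only forward moves are given.\<close>

lemma ex_periodic_word:
  assumes N: "0 < N"
    and d: "\<And>n. n < N \<Longrightarrow> d n \<in> C" "\<And>n. n < N \<Longrightarrow> m n (d n) = - 1"
    and step: "\<And>n a. n < N \<Longrightarrow> a \<in> C \<Longrightarrow> m (Suc n) a = m n a + \<theta> (d n) a"
    and period: "\<And>a. a \<in> C \<Longrightarrow> m N a = m 0 a"
  obtains c M where "weighted_word C c M" "\<And>a. M 0 a = m 0 a"
    "\<And>n k. n < N \<Longrightarrow> c (int n + int N * k) = d n"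
proof -
  define idx where "idx k = nat (k mod int N)" for k
  have lt: "idx k < N" for k
    using N by (simp add: idx_def nat_less_iff)
  have M_step: "m (idx (k + 1)) a = m (idx k) a + \<theta> (d (idx k)) a" if "a \<in> C" for k a
  proof (cases "Suc (idx k) = N")
    \<comment> \<open>At the last index of a period the next index is 0; \<open>period\<close>
      closes the loop.\<close>
    case True
    moreover have "0 \<le> k mod int N" using N by simp
    ultimately have "int N = k mod int N + 1" unfolding idx_def by linarith
    then have "(k + 1) mod int N = 0"
      by (metis mod_add_left_eq mod_self)
    then have "idx (k + 1) = 0" by (simp add: idx_def)
    then show ?thesis using step[OF lt that, of k] period[OF that] True by simp
  next
    case False
    have "0 \<le> k mod int N" using N by simp
    moreover have "k mod int N + 1 < int N"
      using False lt[of k] \<open>0 \<le> k mod int N\<close> unfolding idx_def by linarith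
    ultimately have "(k + 1) mod int N = k mod int N + 1"
      by (metis add_increasing2 mod_add_left_eq mod_pos_pos_trivial zero_le_one)
    then have "idx (k + 1) = Suc (idx k)"
      using \<open>0 \<le> k mod int N\<close> by (simp add: idx_def nat_add_distrib)
    then show ?thesis using step[OF lt that] by simp
  qed
  have "weighted_word C (\<lambda>k. d (idx k)) (\<lambda>k. m (idx k))"
    using d lt M_step by (auto simp: weighted_word_def)
  moreover have "idx 0 = 0" by (simp add: idx_def)
  moreover have "idx (int n + int N * k) = n" if "n < N" for n k
    using that by (simp add: idx_def)
  ultimately show thesis
    using that[of "\<lambda>k. d (idx k)" "\<lambda>k. m (idx k)"] by simp
qed

lemma weighted_word_sum:
  assumes "weighted_word C c M" "a \<in> C" "i \<le> j"
  shows "M j a = M i a + (\<Sum>k\<in>{i..<j}. \<theta> (c k) a)"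
  using assms(3)
proof (induction j rule: int_ge_induct)
  case (step j)
  have "{i..<j + 1} = insert j {i..<j}" using step.hyps by auto
  then show ?case using step assms(1,2) by (auto simp: weighted_word_def)
qed simp

text \<open>A move at \<open>c i\<close> turns its entry from -1 into
  \<open>- 1 + \<theta> (c i) (c i) = 1\<close>; at \<open>j\<close> the entry is -1 again, so the
  letters in between lower it by 2.\<close>

lemma weighted_word_gap:
  assumes w: "weighted_word C c M" and "C \<subseteq> \<Gamma>" and ij: "i < j" "c j = c i"
  shows "(\<Sum>k\<in>{i<..<j}. - \<theta> (c k) (c i)) = 2"
proof -
  have ci: "c i \<in> C" "M i (c i) = - 1" "M j (c i) = - 1"
    "M (i + 1) (c i) = M i (c i) + \<theta> (c i) (c i)"
    using w ij(2) unfolding weighted_word_def by metis+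
  have "M (i + 1) (c i) = 1" using ci theta_diag assms(2) by auto
  moreover have "{i<..<j} = {i + 1..<j}" by auto
  ultimately show ?thesis
    using weighted_word_sum[OF w ci(1), of "i + 1" j] ij(1) ci(3) by (simp add: sum_negf)
qed

end

context colored_d_complete
begin

lemma color_class_chain:
  "x \<in> color_class a \<Longrightarrow> y \<in> color_class a \<Longrightarrow> (x, y) \<in> r \<or> (y, x) \<in> r"
  using EC by (auto simp: color_class_def comparable_def)

lemma theta_nonzero_comparable:
  assumes "x \<in> P" "y \<in> P" "\<theta> (\<kappa> x) (\<kappa> y) \<noteq> 0"
  shows "(x, y) \<in> r \<or> (y, x) \<in> r"
proof (cases "\<kappa> x = \<kappa> y")
  case True
  then show ?thesis using EC assms by (auto simp: comparable_def)
next
  case False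
  then have "adj (\<kappa> x) (\<kappa> y)" using theta_nonadj assms color_in by blast
  then show ?thesis using AC assms by (auto simp: comparable_def)
qed

lemma maximal_in_greatest:
  "maximal_in (color_class a) t \<Longrightarrow> y \<in> color_class a \<Longrightarrow> (y, t) \<in> r"
  using color_class_chain[of y a t] le_refl
  by (auto simp: maximal_in_def color_class_def)

lemma ex_next:
  assumes "y \<in> color_class a" "z \<in> color_class a" "(y, z) \<in> r" "y \<noteq> z"
  obtains x where "consecutive a y x"
proof -
  let ?A = "{w \<in> color_class a. (y, w) \<in> r \<and> (w, z) \<in> r \<and> w \<noteq> y}"
  have fin: "finite ?A" by (rule finite_subset[OF _ finite_interval[of y z]]) (auto simp: closed_interval_def)
  have "z \<in> ?A" using assms le_refl le_in by auto
  then obtain x where x: "x \<in> ?A" "\<And>w. w \<in> ?A \<Longrightarrow> (w, x) \<in> r \<Longrightarrow> w = x"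
    using ex_minimal[OF fin] by blast
  have "w \<notin> color_class a" if w: "w \<in> open_interval r y x" for w
  proof
    assume "w \<in> color_class a"
    then have "w \<in> ?A" using w x(1) le_trans[of w x z]
      by (auto simp: open_interval_def closed_interval_def)
    then show False using x(2)[of w] w by (auto simp: open_interval_def closed_interval_def)
  qed
  then have "consecutive a y x" using x(1) assms(1) by (auto simp: consecutive_def)
  then show thesis by (rule that)
qed

lemma ex_previous:
  assumes "y \<in> color_class a" "z \<in> color_class a" "(y, z) \<in> r" "y \<noteq> z"
  obtains x where "consecutive a x z"
proof -
  let ?A = "{w \<in> color_class a. (y, w) \<in> r \<and> (w, z) \<in> r \<and> w \<noteq> z}"
  have fin: "finite ?A" by (rule finite_subset[OF _ finite_interval[of y z]]) (auto simp: closed_interval_def)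
  have "y \<in> ?A" using assms le_refl le_in by auto
  then obtain x where x: "x \<in> ?A" "\<And>w. w \<in> ?A \<Longrightarrow> (x, w) \<in> r \<Longrightarrow> w = x"
    using ex_maximal[OF fin] by blast
  have "w \<notin> color_class a" if w: "w \<in> open_interval r x z" for w
  proof
    assume "w \<in> color_class a"
    then have "w \<in> ?A" using w x(1) le_trans[of y x w]
      by (auto simp: open_interval_def closed_interval_def)
    then show False using x(2)[of w] w by (auto simp: open_interval_def closed_interval_def)
  qed
  then have "consecutive a x z" using x(1) assms(2) by (auto simp: consecutive_def)
  then show thesis by (rule that)
qed

section \<open>Filters that carry a weight, and the range of its entries\<close>

definition upset :: "'a set \<Rightarrow> bool"
  where "upset F \<longleftrightarrow> F \<subseteq> P \<and> (\<forall>x\<in>F. \<forall>y. (x, y) \<in> r \<longrightarrow> y \<in> F)"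

lemma upsetD: "upset F \<Longrightarrow> x \<in> F \<Longrightarrow> (x, y) \<in> r \<Longrightarrow> y \<in> F"
  by (auto simp: upset_def)

text \<open>What the weight needs. Each color that occurs in \<open>F\<close> has a least element
  there, since its class either continues outside \<open>F\<close> (colors in \<open>C\<close>) or
  is finite; each color that does not occur has a maximum to refer to.\<close>

definition good_filter :: "'c set \<Rightarrow> 'a set \<Rightarrow> bool"
  where "good_filter C F \<longleftrightarrow> upset F \<and> C \<subseteq> \<Gamma> \<and> (\<forall>a\<in>C. \<not> color_class a \<subseteq> F) \<and>
    (\<forall>a\<in>\<Gamma> - C. finite (color_class a)) \<and>
    (\<forall>a\<in>\<Gamma>. F \<inter> color_class a = {} \<longrightarrow> (\<exists>t. maximal_in (color_class a) t))"

definition least_of :: "'a set \<Rightarrow> 'c \<Rightarrow> 'a"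
  where "least_of F a = (SOME x. x \<in> F \<inter> color_class a \<and> (\<forall>y\<in>F \<inter> color_class a. (x, y) \<in> r))"

definition top_of :: "'c \<Rightarrow> 'a"
  where "top_of a = (SOME t. maximal_in (color_class a) t)"

definition min_of :: "'a set \<Rightarrow> 'a \<Rightarrow> bool"
  where "min_of F x \<longleftrightarrow> x \<in> F \<and> (\<forall>z\<in>F. (z, x) \<in> r \<longrightarrow> z = x)"

text \<open>The weight attached to the split of \<open>P\<close> into \<open>P - F\<close> and \<open>F\<close>: for a finite filter
  \<open>F\<close> it is the pairing with the simple coroots of \<open>\<lambda> - (\<Sum>z\<in>F. \<alpha>\<^bsub>\<kappa> z\<^esub>)\<close>, where \<open>\<lambda>\<close> is a
  dominant weight; the present form makes sense for infinite \<open>F\<close> as well.\<close>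

definition weight :: "'a set \<Rightarrow> 'c \<Rightarrow> int"
  where "weight F a = (if F \<inter> color_class a = {}
    then 1 - (\<Sum>z\<in>upper_adjacent (top_of a) - F. - \<theta> (\<kappa> z) a)
    else - 1 + (\<Sum>z\<in>{z \<in> F. (z, least_of F a) \<in> r \<and> z \<noteq> least_of F a}. - \<theta> (\<kappa> z) a))"

lemma good_filterD:
  assumes "good_filter C F"
  shows "F \<subseteq> P" "upset F" "C \<subseteq> \<Gamma>"
  using assms by (auto simp: good_filter_def upset_def)

lemma good_filter_omits: "good_filter C F \<Longrightarrow> a \<in> C \<Longrightarrow> \<exists>b\<in>color_class a. b \<notin> F"
  by (auto simp: good_filter_def)

text \<open>For \<open>a\<close> in \<open>C\<close>, an element of the class outside the up-closed
  \<open>F\<close> lies below all elements of the class in \<open>F\<close>, so local finiteness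
  applies.\<close>

lemma least_of:
  assumes F: "good_filter C F" and a: "a \<in> \<Gamma>" and ne: "F \<inter> color_class a \<noteq> {}"
  shows "least_of F a \<in> F" "least_of F a \<in> color_class a"
    "\<And>y. y \<in> F \<Longrightarrow> y \<in> color_class a \<Longrightarrow> (least_of F a, y) \<in> r"
proof -
  obtain x0 where x0: "x0 \<in> F" "x0 \<in> color_class a" using ne by blast
  let ?A = "{y \<in> F \<inter> color_class a. (y, x0) \<in> r}"
  have fin: "finite ?A"
  proof (cases "a \<in> C")
    case True
    then obtain b where b: "b \<in> color_class a" "b \<notin> F"
      using good_filter_omits[OF F] by blast
    have "(b, y) \<in> r" if "y \<in> F" "y \<in> color_class a" for y
      using color_class_chain[OF b(1) that(2)] upsetD[OF good_filterD(2)[OF F] that(1), of b] b(2)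
      by blast
    then have "?A \<subseteq> closed_interval r b x0" by (auto simp: closed_interval_def)
    then show ?thesis by (rule finite_subset) (rule finite_interval)
  next
    case False
    then have "finite (color_class a)" using F a by (auto simp: good_filter_def)
    then show ?thesis by (rule finite_subset[rotated]) auto
  qed
  have "x0 \<in> ?A" using x0 le_refl by (auto simp: color_class_def)
  then obtain m where m: "m \<in> ?A" "\<And>w. w \<in> ?A \<Longrightarrow> (w, m) \<in> r \<Longrightarrow> w = m"
    using ex_minimal[OF fin] by blast
  have "(m, y) \<in> r" if y: "y \<in> F \<inter> color_class a" for y
  proof (cases "(y, x0) \<in> r")
    case True
    then have "y \<in> ?A" using y by blast
    then show ?thesis using m(2)[of y] color_class_chain[of y a m] y m(1) by auto
  next
    case False
    then have "(x0, y) \<in> r" using color_class_chain[of y a x0] y x0(2) by blast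
    then show ?thesis using m(1) le_trans[of m x0 y] by simp
  qed
  then have "m \<in> F \<inter> color_class a \<and> (\<forall>y\<in>F \<inter> color_class a. (m, y) \<in> r)" using m(1) by blast
  then have *: "least_of F a \<in> F \<inter> color_class a \<and> (\<forall>y\<in>F \<inter> color_class a. (least_of F a, y) \<in> r)"
    unfolding least_of_def by (rule someI)
  then show "least_of F a \<in> F" "least_of F a \<in> color_class a"
    "\<And>y. y \<in> F \<Longrightarrow> y \<in> color_class a \<Longrightarrow> (least_of F a, y) \<in> r" by blast+
qed

lemma top_of:
  assumes "good_filter C F" "a \<in> \<Gamma>" "F \<inter> color_class a = {}"
  shows "maximal_in (color_class a) (top_of a)"
proof -
  have "\<exists>t. maximal_in (color_class a) t" using assms by (auto simp: good_filter_def)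
  then show ?thesis unfolding top_of_def by (rule someI_ex)
qed

text \<open>Every element of \<open>F\<close> lies above the least one of its color, and there are
  finitely many colors.\<close>

lemma finite_below:
  assumes F: "good_filter C F"
  shows "finite {z \<in> F. (z, x) \<in> r}"
proof -
  have "{z \<in> F. (z, x) \<in> r} \<subseteq> (\<Union>a\<in>\<Gamma>. closed_interval r (least_of F a) x)"
  proof
    fix z assume z: "z \<in> {z \<in> F. (z, x) \<in> r}"
    then have zP: "z \<in> P" using good_filterD[OF F] by blast
    then have "z \<in> color_class (\<kappa> z)" by (simp add: color_class_def)
    then have "(least_of F (\<kappa> z), z) \<in> r"
      using least_of(3)[OF F color_in[OF zP]] z by blast
    then show "z \<in> (\<Union>a\<in>\<Gamma>. closed_interval r (least_of F a) x)"
      using z color_in[OF zP] by (auto simp: closed_interval_def)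
  qed
  then show ?thesis by (rule finite_subset) (simp add: finite_colors finite_interval)
qed

lemma ex_min_of:
  assumes F: "good_filter C F" and ne: "F \<noteq> {}"
  shows "\<exists>x. min_of F x"
proof -
  obtain x0 where x0: "x0 \<in> F" using ne by blast
  then have "{z \<in> F. (z, x0) \<in> r} \<noteq> {}" using good_filterD(1)[OF F] le_refl by auto
  from ex_minimal[OF finite_below[OF F] this] obtain m where m: "m \<in> {z \<in> F. (z, x0) \<in> r}"
    "\<And>z. z \<in> {z \<in> F. (z, x0) \<in> r} \<Longrightarrow> (z, m) \<in> r \<Longrightarrow> z = m"
    by blast
  have "min_of F m" unfolding min_of_def
  proof (intro conjI ballI impI)
    show "m \<in> F" using m(1) by simp
    fix z assume z: "z \<in> F" "(z, m) \<in> r"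
    then have "(z, x0) \<in> r" using m(1) le_trans[of z m x0] by simp
    then show "z = m" using m(2) z by simp
  qed
  then show ?thesis by blast
qed

lemma below_least_nonpos:
  assumes F: "good_filter C F" and a: "a \<in> \<Gamma>" and ne: "F \<inter> color_class a \<noteq> {}"
    and z: "z \<in> F" "(z, least_of F a) \<in> r" "z \<noteq> least_of F a"
  shows "\<theta> (\<kappa> z) a \<le> 0" "\<kappa> z \<noteq> a"
proof -
  have zP: "z \<in> P" using z good_filterD(1)[OF F] by blast
  show "\<kappa> z \<noteq> a"
  proof
    assume "\<kappa> z = a"
    then have "(least_of F a, z) \<in> r" using least_of(3)[OF F a ne z(1)] zP by (simp add: color_class_def)
    then show False using le_antisym z by blast
  qed
  then show "\<theta> (\<kappa> z) a \<le> 0" using theta_nonpos color_in[OF zP] a by blast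
qed

lemma upper_adjacent_theta: "z \<in> upper_adjacent x \<Longrightarrow> \<theta> (\<kappa> z) (\<kappa> x) \<le> - 1"
  using theta_adj by (auto simp: upper_adjacent_def)

text \<open>Here the bound 1 of UCB1 enters: the subtracted sum is a part of the one that UCB1
  bounds.\<close>

lemma weight_empty_nonneg:
  assumes F: "good_filter C F" and a: "a \<in> \<Gamma>" and e: "F \<inter> color_class a = {}"
  shows "0 \<le> weight F a" "weight F a \<le> 1"
proof -
  note t = top_of[OF assms]
  have ta: "\<kappa> (top_of a) = a" using t by (auto simp: maximal_in_def color_class_def)
  have fin: "finite (upper_adjacent (top_of a))" and
    le: "(\<Sum>z\<in>upper_adjacent (top_of a). - \<theta> (\<kappa> z) a) \<le> 1" using UCB1[OF a t] by auto
  have pos: "0 \<le> - \<theta> (\<kappa> z) a" if "z \<in> upper_adjacent (top_of a)" for z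
    using upper_adjacent_theta[OF that] ta by simp
  have "(\<Sum>z\<in>upper_adjacent (top_of a) - F. - \<theta> (\<kappa> z) a)
      \<le> (\<Sum>z\<in>upper_adjacent (top_of a). - \<theta> (\<kappa> z) a)"
    using fin pos by (intro sum_mono2) auto
  moreover have "0 \<le> (\<Sum>z\<in>upper_adjacent (top_of a) - F. - \<theta> (\<kappa> z) a)"
    using pos by (intro sum_nonneg) auto
  ultimately show "0 \<le> weight F a" "weight F a \<le> 1" using e le by (auto simp: weight_def)
qed

lemma weight_ge:
  assumes F: "good_filter C F" and a: "a \<in> \<Gamma>"
  shows "- 1 \<le> weight F a"
proof (cases "F \<inter> color_class a = {}")
  case True
  then show ?thesis using weight_empty_nonneg(1)[OF assms] by simp
next
  case False
  have "0 \<le> (\<Sum>z\<in>{z \<in> F. (z, least_of F a) \<in> r \<and> z \<noteq> least_of F a}. - \<theta> (\<kappa> z) a)"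
    using below_least_nonpos(1)[OF F a False] by (intro sum_nonneg) auto
  then show ?thesis using False by (simp add: weight_def)
qed

text \<open>The entry -1 excludes the case of a missing color and forces a sum of nonnegative terms
  to vanish. If the least element were not minimal in \<open>F\<close>, it would cover an element of
  \<open>F\<close>, whose color is adjacent by NA and whose term is positive.\<close>

lemma weight_minus_one:
  assumes F: "good_filter C F" and a: "a \<in> \<Gamma>" and w: "weight F a = - 1"
  shows "min_of F (least_of F a)" "least_of F a \<in> color_class a"
proof -
  have ne: "F \<inter> color_class a \<noteq> {}" using weight_empty_nonneg(1)[OF F a] w by auto
  note l = least_of[OF F a ne]
  show "least_of F a \<in> color_class a" by (rule l(2))
  let ?B = "{z \<in> F. (z, least_of F a) \<in> r \<and> z \<noteq> least_of F a}"
  have fin: "finite ?B" by (rule finite_subset[OF _ finite_below[OF F, of "least_of F a"]]) auto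
  have "(\<Sum>z\<in>?B. - \<theta> (\<kappa> z) a) = 0" using w ne by (simp add: weight_def)
  then have zero: "\<theta> (\<kappa> z) a = 0" if "z \<in> ?B" for z
    using sum_nonneg_0[OF fin, of "\<lambda>z. - \<theta> (\<kappa> z) a" z] below_least_nonpos(1)[OF F a ne] that by auto
  show "min_of F (least_of F a)" unfolding min_of_def
  proof (intro conjI ballI impI)
    show "least_of F a \<in> F" by (rule l(1))
    fix z assume z: "z \<in> F" "(z, least_of F a) \<in> r"
    show "z = least_of F a"
    proof (rule ccontr)
      assume "z \<noteq> least_of F a"
      then obtain y where y: "covers r (least_of F a) y" "(z, y) \<in> r"
        using ex_cover_below z(2) by blast
      have yF: "y \<in> F" using upsetD[OF good_filterD(2)[OF F] z(1) y(2)] .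
      then have "y \<in> ?B" using y(1) by (auto simp: covers_def)
      moreover have "adj (\<kappa> y) (\<kappa> (least_of F a))"
        using NA[of y "least_of F a"] y(1) yF l(1) good_filterD(1)[OF F]
        by (auto simp: neighbors_def)
      ultimately show False using zero[of y] l(2) theta_adj by (force simp: color_class_def)
    qed
  qed
qed

lemma weight_of_min:
  assumes F: "good_filter C F" and x: "min_of F x"
  shows "weight F (\<kappa> x) = - 1" "least_of F (\<kappa> x) = x"
proof -
  have xF: "x \<in> F" "x \<in> P" using x good_filterD(1)[OF F] by (auto simp: min_of_def)
  have xa: "x \<in> color_class (\<kappa> x)" using xF by (simp add: color_class_def)
  then have ne: "F \<inter> color_class (\<kappa> x) \<noteq> {}" using xF by blast
  note l = least_of[OF F color_in[OF xF(2)] ne]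
  show eq: "least_of F (\<kappa> x) = x" using l(1) l(3)[OF xF(1) xa] x by (auto simp: min_of_def)
  have "{z \<in> F. (z, x) \<in> r \<and> z \<noteq> x} = {}" using x by (auto simp: min_of_def)
  then show "weight F (\<kappa> x) = - 1" unfolding weight_def eq using ne by (simp only: sum.empty if_False)
qed

text \<open>Let \<open>m\<close> precede the least element in its class; it lies outside
  \<open>F\<close>. Elements of \<open>F\<close> with a nonzero term are comparable to
  \<open>m\<close> but not below it, so they lie in an interval whose ICE2 sum is 2.\<close>

lemma weight_le:
  assumes F: "good_filter C F" and a: "a \<in> C"
  shows "weight F a \<le> 1"
proof (cases "F \<inter> color_class a = {}")
  case True
  then show ?thesis using weight_empty_nonneg(2)[OF F _ True] a good_filterD(3)[OF F] by blast
next
  case False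
  have aG: "a \<in> \<Gamma>" using a good_filterD(3)[OF F] by blast
  note l = least_of[OF F aG False]
  obtain b where b: "b \<in> color_class a" "b \<notin> F" using good_filter_omits[OF F a] by blast
  have "(b, least_of F a) \<in> r"
    using color_class_chain[OF b(1) l(2)] upsetD[OF good_filterD(2)[OF F] l(1)] b(2) by blast
  then obtain m where m: "consecutive a m (least_of F a)"
    using ex_previous[OF b(1) l(2)] b(2) l(1) by metis
  then have mr: "(m, least_of F a) \<in> r" "m \<noteq> least_of F a" "m \<in> color_class a"
    by (auto simp: consecutive_def)
  have mF: "m \<notin> F" using l(3)[of m] mr le_antisym by blast
  let ?B = "{z \<in> F. (z, least_of F a) \<in> r \<and> z \<noteq> least_of F a}"
  let ?I = "open_interval r m (least_of F a)"
  have fin: "finite ?B" by (rule finite_subset[OF _ finite_below[OF F, of "least_of F a"]]) auto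
  have "\<theta> (\<kappa> z) a = 0" if z: "z \<in> ?B - ?I" for z
  proof (rule ccontr)
    assume nz: "\<theta> (\<kappa> z) a \<noteq> 0"
    have zP: "z \<in> P" using z good_filterD(1)[OF F] by blast
    have "(z, m) \<in> r \<or> (m, z) \<in> r"
      using theta_nonzero_comparable[OF zP, of m] nz mr(3) by (auto simp: color_class_def)
    moreover have "(z, m) \<notin> r" using z mF upsetD[OF good_filterD(2)[OF F]] by blast
    moreover have "z \<noteq> m" using z mF by blast
    ultimately show False using z by (auto simp: open_interval_def closed_interval_def)
  qed
  then have "(\<Sum>z\<in>?B. - \<theta> (\<kappa> z) a) = (\<Sum>z\<in>?B \<inter> ?I. - \<theta> (\<kappa> z) a)"
    using fin by (intro sum.mono_neutral_right) auto
  also have "\<dots> \<le> (\<Sum>z\<in>?I. - \<theta> (\<kappa> z) a)"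
  proof (rule sum_mono2)
    fix z assume z: "z \<in> ?I - ?B \<inter> ?I"
    then have zP: "z \<in> P" using le_in by (auto simp: open_interval_def closed_interval_def)
    then have "\<kappa> z \<noteq> a" using z m by (auto simp: consecutive_def color_class_def)
    then show "0 \<le> - \<theta> (\<kappa> z) a" using theta_nonpos color_in[OF zP] aG by simp
  qed (auto simp: finite_open_interval)
  also have "\<dots> = 2" by (rule ICE2[OF aG m])
  finally show ?thesis using False by (simp add: weight_def)
qed

text \<open>If \<open>x\<close> is the only element of its color in \<open>F\<close>, it is the
  maximum of its class because \<open>F\<close> is up-closed; so the clause on missing colors
  survives.\<close>

lemma good_filter_remove:
  assumes F: "good_filter C F" and x: "min_of F x"
  shows "good_filter C (F - {x})"
proof -
  have up: "upset (F - {x})"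
    unfolding upset_def
  proof (intro conjI ballI allI impI)
    show "F - {x} \<subseteq> P" using good_filterD(1)[OF F] by blast
    fix u v assume u: "u \<in> F - {x}" "(u, v) \<in> r"
    then show "v \<in> F - {x}" using upsetD[OF good_filterD(2)[OF F], of u v] x by (auto simp: min_of_def)
  qed
  have "\<exists>t. maximal_in (color_class a) t" if a: "a \<in> \<Gamma>" and e: "(F - {x}) \<inter> color_class a = {}" for a
  proof (cases "F \<inter> color_class a = {}")
    case True
    then show ?thesis using F a by (auto simp: good_filter_def)
  next
    case False
    then have "x \<in> color_class a" "x \<in> F" using e by blast+
    moreover have "y = x" if "y \<in> color_class a" "(x, y) \<in> r" for y
      using that e upsetD[OF good_filterD(2)[OF F] \<open>x \<in> F\<close>] by blast
    ultimately have "maximal_in (color_class a) x" by (auto simp: maximal_in_def)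
    then show ?thesis ..
  qed
  then show ?thesis using up F by (auto simp: good_filter_def)
qed

end

section \<open>Reflections and periodicity\<close>

context colored_d_complete
begin

text \<open>Removing a minimal element acts on weights as a simple reflection does.\<close>

lemma weight_remove:
  assumes F: "good_filter C F" and x: "min_of F x" and a: "a \<in> \<Gamma>"
  shows "weight (F - {x}) a = weight F a + \<theta> (\<kappa> x) a"
proof -
  have F': "good_filter C (F - {x})" by (rule good_filter_remove[OF F x])
  have xF: "x \<in> F" "x \<in> P" using x good_filterD(1)[OF F] by (auto simp: min_of_def)
  have up: "\<And>u v. u \<in> F \<Longrightarrow> (u, v) \<in> r \<Longrightarrow> v \<in> F" using upsetD[OF good_filterD(2)[OF F]] .
  have not_below: "(z, x) \<notin> r" if "z \<in> F" "z \<noteq> x" for z using x that by (auto simp: min_of_def)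
  have above: "(x, z) \<in> r" if "z \<in> F" "\<theta> (\<kappa> z) (\<kappa> x) \<noteq> 0" for z
    using theta_nonzero_comparable[of z x] that xF(2) good_filterD(1)[OF F] not_below[of z] le_refl
    by blast
  show ?thesis
  proof (cases "\<kappa> x = a")
    case True
    have w: "weight F a = - 1" using weight_of_min(1)[OF F x] True by simp
    have xa: "x \<in> color_class a" using xF True by (simp add: color_class_def)
    \<comment> \<open>The value is the constant 1 of the empty case if \<open>x\<close> was the top
      of its class, as then all of \<open>upper_adjacent x\<close> lies in \<open>F\<close>;
      otherwise it is -1 plus the ICE2 sum from \<open>x\<close> to the next element.\<close>
    have "weight (F - {x}) a = 1"
    proof (cases "(F - {x}) \<inter> color_class a = {}")
      case e: True
      note t = top_of[OF F' a e]
      have "(x, top_of a) \<in> r" by (rule maximal_in_greatest[OF t xa])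
      then have "top_of a \<in> F \<inter> color_class a" using up[OF xF(1)] t by (auto simp: maximal_in_def)
      then have tx: "top_of a = x" using e by blast
      have "upper_adjacent x - (F - {x}) = {}" using up[OF xF(1)] by (auto simp: upper_adjacent_def)
      then have "(\<Sum>z\<in>upper_adjacent (top_of a) - (F - {x}). - \<theta> (\<kappa> z) a) = 0"
        unfolding tx by (simp only: sum.empty)
      then show ?thesis using e by (simp add: weight_def)
    next
      case ne: False
      define y where "y = least_of (F - {x}) a"
      note l = least_of[OF F' a ne, folded y_def]
      have xy: "(x, y) \<in> r" "x \<noteq> y"
        using color_class_chain[OF xa l(2)] not_below[of y] l(1) by auto
      have "w \<notin> color_class a" if w: "w \<in> open_interval r x y" for w
      proof
        assume wa: "w \<in> color_class a"
        have wr: "(x, w) \<in> r" "(w, y) \<in> r" "w \<noteq> x" "w \<noteq> y"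
          using w by (auto simp: open_interval_def closed_interval_def)
        then have "(y, w) \<in> r" using l(3)[OF _ wa] up[OF xF(1)] by blast
        then show False using wr le_antisym by blast
      qed
      then have cons: "consecutive a x y"
        using xy xa l(2) by (auto simp: consecutive_def)
      let ?B = "{z \<in> F - {x}. (z, y) \<in> r \<and> z \<noteq> y}"
      have fin: "finite ?B" by (rule finite_subset[OF _ finite_below[OF F', of y]]) auto
      have sub: "open_interval r x y \<subseteq> ?B"
        using up[OF xF(1)] by (auto simp: open_interval_def closed_interval_def)
      have zero: "\<theta> (\<kappa> z) a = 0" if z: "z \<in> ?B - open_interval r x y" for z
      proof (rule ccontr)
        assume "\<theta> (\<kappa> z) a \<noteq> 0"
        then have "(x, z) \<in> r" using above[of z] z True by simp
        then show False using z by (auto simp: open_interval_def closed_interval_def)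
      qed
      have "(\<Sum>z\<in>?B. - \<theta> (\<kappa> z) a) = (\<Sum>z\<in>open_interval r x y. - \<theta> (\<kappa> z) a)"
        using fin sub zero by (intro sum.mono_neutral_right) auto
      also have "\<dots> = 2" by (rule ICE2[OF a cons])
      finally show ?thesis using ne by (simp add: weight_def y_def)
    qed
    then show ?thesis using w True theta_diag[OF a] by simp
  next
    case False
    \<comment> \<open>The reference element for color \<open>a\<close> does not change. If the
      colors are adjacent, \<open>x\<close> joins the elements subtracted above
      \<open>top_of a\<close>, or leaves those counted below \<open>least_of F a\<close>.\<close>
    have eq: "(F - {x}) \<inter> color_class a = F \<inter> color_class a"
      using False by (auto simp: color_class_def)
    show ?thesis
    proof (cases "F \<inter> color_class a = {}")
      case e: True
      note t = top_of[OF F a e]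
      have ta: "top_of a \<in> P" "\<kappa> (top_of a) = a" "top_of a \<notin> F"
        using t e by (auto simp: maximal_in_def color_class_def)
      have fin: "finite (upper_adjacent (top_of a))" using UCB1[OF a t] by simp
      have tx: "(x, top_of a) \<notin> r" using up[OF xF(1)] ta by blast
      show ?thesis
      proof (cases "adj (\<kappa> x) a")
        case True
        then have "(top_of a, x) \<in> r" using AC[OF xF(2) ta(1)] ta(2) tx by (auto simp: comparable_def)
        then have xu: "x \<in> upper_adjacent (top_of a)"
          using True xF ta by (auto simp: upper_adjacent_def)
        have "upper_adjacent (top_of a) - (F - {x}) = insert x (upper_adjacent (top_of a) - F)"
          using xu by blast
        then have "(\<Sum>z\<in>upper_adjacent (top_of a) - (F - {x}). - \<theta> (\<kappa> z) a)
            = - \<theta> (\<kappa> x) a + (\<Sum>z\<in>upper_adjacent (top_of a) - F. - \<theta> (\<kappa> z) a)"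
          using fin xF(1) by simp
        then show ?thesis using e eq by (simp add: weight_def)
      next
        case nadj: False
        have "x \<notin> upper_adjacent (top_of a)" using nadj ta(2) by (auto simp: upper_adjacent_def)
        then have "upper_adjacent (top_of a) - (F - {x}) = upper_adjacent (top_of a) - F" by blast
        moreover have "\<theta> (\<kappa> x) a = 0" using theta_nonadj nadj False color_in[OF xF(2)] a by blast
        ultimately show ?thesis using e eq by (simp add: weight_def)
      qed
    next
      case ne: False
      have same: "least_of (F - {x}) a = least_of F a" unfolding least_of_def eq ..
      define y where "y = least_of F a"
      note l = least_of[OF F a ne, folded y_def]
      let ?B = "{z \<in> F. (z, y) \<in> r \<and> z \<noteq> y}"
      have fin: "finite ?B" by (rule finite_subset[OF _ finite_below[OF F, of y]]) auto
      have B': "{z \<in> F - {x}. (z, y) \<in> r \<and> z \<noteq> y} = ?B - {x}" by blast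
      have yx: "y \<noteq> x" "\<kappa> y = a" "y \<in> P" using l(2) False by (auto simp: color_class_def)
      have "(\<Sum>z\<in>?B - {x}. - \<theta> (\<kappa> z) a) = (\<Sum>z\<in>?B. - \<theta> (\<kappa> z) a) + \<theta> (\<kappa> x) a"
      proof (cases "x \<in> ?B")
        case True
        then show ?thesis using fin by (simp add: sum_diff1)
      next
        case xB: False
        have "\<theta> (\<kappa> x) a = 0"
        proof (rule ccontr)
          assume "\<theta> (\<kappa> x) a \<noteq> 0"
          then have "(x, y) \<in> r"
            using theta_nonzero_comparable[OF xF(2) yx(3)] yx not_below[OF l(1)] by blast
          then show False using xB xF(1) yx(1) by blast
        qed
        then show ?thesis using xB by simp
      qed
      then show ?thesis using ne eq same B' by (simp add: weight_def y_def)
    qed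
  qed
qed

text \<open>At each stage the weight agrees with \<open>M\<close> on \<open>C\<close>, so the entry
  -1 at the next letter exhibits a minimal element of that color. Its removal updates both sides
  alike, so the process never stops.\<close>

lemma weighted_word_removal:
  assumes F: "good_filter C F" and w: "weighted_word C c M"
    and start: "\<And>a. a \<in> C \<Longrightarrow> weight F a = M 0 a"
  shows "\<exists>x :: nat \<Rightarrow> 'a. \<forall>n. min_of (F - x ` {..<n}) (x n) \<and> \<kappa> (x n) = c (int n) \<and>
    good_filter C (F - x ` {..<n})"
proof -
  define G where "G = rec_nat F (\<lambda>n G. G - {least_of G (c (int n))})"
  define x where "x n = least_of (G n) (c (int n))" for n
  have G: "G 0 = F" "\<And>n. G (Suc n) = G n - {x n}" by (simp_all add: G_def x_def)
  have G_eq: "G n = F - x ` {..<n}" for n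
    by (induction n) (auto simp: G lessThan_Suc)
  have min: "min_of (G n) (x n)" "\<kappa> (x n) = c (int n)"
    if g: "good_filter C (G n)" "\<And>a. a \<in> C \<Longrightarrow> weight (G n) a = M (int n) a" for n
  proof -
    have cn: "c (int n) \<in> C" "M (int n) (c (int n)) = - 1" using w by (auto simp: weighted_word_def)
    then have "weight (G n) (c (int n)) = - 1" using g(2) by simp
    from weight_minus_one[OF g(1) _ this]
    show "min_of (G n) (x n)" "\<kappa> (x n) = c (int n)"
      using cn good_filterD(3)[OF g(1)] by (auto simp: x_def color_class_def)
  qed
  have inv: "good_filter C (G n) \<and> (\<forall>a\<in>C. weight (G n) a = M (int n) a)" for n
  proof (induction n)
    case 0
    then show ?case using F start by (simp add: G)
  next
    case (Suc n)
    then have g: "good_filter C (G n)" and m: "min_of (G n) (x n)" "\<kappa> (x n) = c (int n)"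
      using min by blast+
    have "weight (G (Suc n)) a = M (int (Suc n)) a" if a: "a \<in> C" for a
    proof -
      have "a \<in> \<Gamma>" using a good_filterD(3)[OF F] by blast
      then have "weight (G (Suc n)) a = M (int n) a + \<theta> (c (int n)) a"
        using weight_remove[OF g m(1)] Suc a m(2) by (simp add: G)
      also have "\<dots> = M (int n + 1) a" using w a by (simp add: weighted_word_def)
      finally show ?thesis by (simp add: add.commute)
    qed
    then show ?case using good_filter_remove[OF g m(1)] by (simp add: G)
  qed
  show ?thesis
  proof (intro exI[of _ x] allI conjI)
    fix n
    show "min_of (F - x ` {..<n}) (x n)" using min(1)[of n] inv[of n] G_eq[of n] by simp
    show "\<kappa> (x n) = c (int n)" using min(2)[of n] inv[of n] by blast
    show "good_filter C (F - x ` {..<n})" using inv[of n] G_eq[of n] by simp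
  qed
qed

lemma weight_pigeonhole:
  assumes "\<And>n :: nat. good_filter C (G n)"
  obtains i j where "i < j" "\<And>a. a \<in> C \<Longrightarrow> weight (G i) a = weight (G j) a"
proof -
  define f where "f n = restrict (weight (G n)) C" for n
  have CG: "C \<subseteq> \<Gamma>" using good_filterD(3)[OF assms] .
  have "f n \<in> C \<rightarrow>\<^sub>E {- 1..1}" for n
    using weight_ge[OF assms] weight_le[OF assms] CG by (auto simp: f_def PiE_def)
  then have "range f \<subseteq> C \<rightarrow>\<^sub>E {- 1..1}" by blast
  moreover have "finite (C \<rightarrow>\<^sub>E {- 1..1 :: int})"
    using finite_subset[OF CG finite_colors] by (intro finite_PiE) auto
  ultimately have "\<not> inj f" using finite_subset finite_imageD infinite_UNIV_nat by metis
  then obtain i j where "f i = f j" "i < j" unfolding inj_def by (metis linorder_neqE)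
  moreover have "weight (G n) a = f n a" if "a \<in> C" for n a using that by (simp add: f_def)
  ultimately show thesis using that[of i j] by simp
qed

lemma removal_inj:
  fixes x :: "nat \<Rightarrow> 'a"
  assumes x: "\<And>n. min_of (F - x ` {..<n}) (x n)"
  shows "inj x"
proof (rule injI)
  have new: "x l \<notin> x ` {..<l}" for l using x[of l] by (simp add: min_of_def)
  have "x k \<noteq> x l" if "k < l" for k l using new[of l] that by (metis imageI lessThan_iff)
  then show "k = l" if "x k = x l" for k l using that by (metis linorder_neqE_nat)
qed

lemma upset_up: "upset (\<Union>x\<in>A. {z. (x, z) \<in> r})"
  using le_in(2) by (auto simp: upset_def intro: le_trans)

text \<open>If every color class has a maximum, colors can be put into two groups according to
  whether their classes are finite. Adding elements downwards to a finite filter, some weight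
  recurs; the same colors can then be removed over and over again from a finite filter.\<close>

lemma bounded_imp_finite:
  assumes top: "\<And>a. a \<in> \<Gamma> \<Longrightarrow> \<exists>t. maximal_in (color_class a) t"
  shows "finite P"
proof (rule ccontr)
  assume inf: "infinite P"
  define C where "C = {a \<in> \<Gamma>. infinite (color_class a)}"
  have fin_up: "finite {z. (x, z) \<in> r}" for x
  proof -
    have "{z. (x, z) \<in> r} \<subseteq> (\<Union>a\<in>\<Gamma>. closed_interval r x (top_of a))"
    proof
      fix z assume z: "z \<in> {z. (x, z) \<in> r}"
      then have zP: "z \<in> P" using le_in by blast
      have "maximal_in (color_class (\<kappa> z)) (top_of (\<kappa> z))"
        unfolding top_of_def using top[OF color_in[OF zP]] by (rule someI_ex)
      then have "(z, top_of (\<kappa> z)) \<in> r"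
        using maximal_in_greatest zP by (simp add: color_class_def)
      then show "z \<in> (\<Union>a\<in>\<Gamma>. closed_interval r x (top_of a))"
        using z color_in[OF zP] by (auto simp: closed_interval_def)
    qed
    then show ?thesis by (rule finite_subset) (simp add: finite_colors finite_interval)
  qed
  \<comment> \<open>A finite filter containing all finite classes: whatever is added below it has a
    color in \<open>C\<close>, where the entries are bounded.\<close>
  define F0 where "F0 = (\<Union>x\<in>(\<Union>a\<in>\<Gamma> - C. color_class a). {z. (x, z) \<in> r})"
  have F0: "finite F0" "upset F0"
  proof -
    show "finite F0" using fin_up finite_colors by (auto simp: F0_def C_def)
    show "upset F0" unfolding F0_def by (rule upset_up)
  qed
  have F0_color: "x \<in> F0" if "x \<in> P" "\<kappa> x \<notin> C" for x
    using that color_in[of x] le_refl[of x] by (auto simp: F0_def color_class_def)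
  have ex_y: "\<exists>y. y \<in> P \<and> y \<notin> F \<and> (\<forall>z. (y, z) \<in> r \<longrightarrow> z = y \<or> z \<in> F)"
    if F: "finite F" for F
  proof -
    obtain x where x: "x \<in> P" "x \<notin> F" using inf F by (meson finite_subset subsetI)
    have "finite {z. (x, z) \<in> r \<and> z \<notin> F}" using fin_up[of x] by simp
    moreover have "{z. (x, z) \<in> r \<and> z \<notin> F} \<noteq> {}" using x le_refl by auto
    ultimately obtain y where y: "y \<in> {z. (x, z) \<in> r \<and> z \<notin> F}"
      "\<And>z. z \<in> {z. (x, z) \<in> r \<and> z \<notin> F} \<Longrightarrow> (y, z) \<in> r \<Longrightarrow> z = y"
      using ex_maximal by blast
    have "z = y \<or> z \<in> F" if "(y, z) \<in> r" for z
      using y that le_trans[of x y z] by blast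
    then show ?thesis using y(1) le_in by blast
  qed
  define nxt where "nxt F = (SOME y. y \<in> P \<and> y \<notin> F \<and> (\<forall>z. (y, z) \<in> r \<longrightarrow> z = y \<or> z \<in> F))" for F
  define G where "G = rec_nat F0 (\<lambda>_ F. insert (nxt F) F)"
  define y where "y n = nxt (G n)" for n
  have G: "G 0 = F0" "\<And>n. G (Suc n) = insert (y n) (G n)" by (simp_all add: G_def y_def)
  have Gfin: "finite (G n)" for n by (induction n) (simp_all add: G F0)
  have y: "y n \<in> P" "y n \<notin> G n" "\<And>z. (y n, z) \<in> r \<Longrightarrow> z = y n \<or> z \<in> G n" for n
    using someI_ex[OF ex_y[OF Gfin[of n]]] by (auto simp: y_def nxt_def)
  have Gup: "upset (G n)" for n
  proof (induction n)
    case (Suc n)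
    then show ?case using y(1,3)[of n] unfolding upset_def G by blast
  qed (simp add: G F0)
  have good: "good_filter C (G n)" for n
  proof -
    have "\<not> color_class a \<subseteq> G n" if "a \<in> C" for a
      using that finite_subset[OF _ Gfin] by (auto simp: C_def)
    then show ?thesis using Gup top by (auto simp: good_filter_def C_def)
  qed
  have F0G: "F0 \<subseteq> G n" for n by (induction n) (auto simp: G)
  have y_color: "\<kappa> (y n) \<in> C" for n using F0_color[OF y(1)] F0G[of n] y(2)[of n] by blast
  have y_min: "min_of (G (Suc n)) (y n)" for n
    using upsetD[OF Gup[of n]] y(2)[of n] by (auto simp: min_of_def G)
  have rem: "G (Suc n) - {y n} = G n" for n using y(2) by (auto simp: G)
  obtain i j where ij: "i < j" "\<And>a. a \<in> C \<Longrightarrow> weight (G i) a = weight (G j) a"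
    using weight_pigeonhole[of C G, OF good] by blast
  have C: "C \<subseteq> \<Gamma>" by (auto simp: C_def)
  \<comment> \<open>Additions are read backwards. \<open>G (Suc n)\<close> loses \<open>y n\<close>,
    so on the way from \<open>G j\<close> to \<open>G i\<close> the removal number \<open>n\<close>,
    counted from 0, is that of \<open>y (j - Suc n)\<close>.\<close>
  obtain c M where cM: "weighted_word C c M" "\<And>a. M 0 a = weight (G (j - 0)) a"
  proof (rule ex_periodic_word[where N = "j - i" and C = C and d = "\<lambda>n. \<kappa> (y (j - Suc n))"
        and m = "\<lambda>n. weight (G (j - n))"])
    show "0 < j - i" using ij(1) by simp
    fix n assume n: "n < j - i"
    then have S: "Suc (j - Suc n) = j - n" by simp
    show "\<kappa> (y (j - Suc n)) \<in> C" by (rule y_color)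
    show "weight (G (j - n)) (\<kappa> (y (j - Suc n))) = - 1"
      using weight_of_min(1)[OF good y_min[of "j - Suc n"]] S by simp
    show "weight (G (j - Suc n)) a = weight (G (j - n)) a + \<theta> (\<kappa> (y (j - Suc n))) a"
      if "a \<in> C" for a
      using weight_remove[OF good y_min[of "j - Suc n"], of a] rem[of "j - Suc n"] that C
      unfolding S by auto
  next
    fix a assume "a \<in> C"
    then show "weight (G (j - (j - i))) a = weight (G (j - 0)) a" using ij by simp
  qed (rule that)
  have "weight (G j) a = M 0 a" if "a \<in> C" for a using cM(2) by simp
  from weighted_word_removal[OF good[of j] cM(1) this]
  obtain x :: "nat \<Rightarrow> 'a" where x: "\<And>n. min_of (G j - x ` {..<n}) (x n)" by metis
  have "inj x" using x by (rule removal_inj)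
  moreover have "range x \<subseteq> G j" using x by (auto simp: min_of_def)
  ultimately show False using Gfin[of j] finite_subset finite_imageD infinite_UNIV_nat by metis
qed

section \<open>Connectedness of the diagram and absence of maxima\<close>

lemma le_color_closed:
  assumes S: "\<And>a b. a \<in> S \<Longrightarrow> adj a b \<Longrightarrow> b \<in> S"
    and "(x, y) \<in> r"
  shows "\<kappa> x \<in> S \<longleftrightarrow> \<kappa> y \<in> S"
  using le_imp_cover_chain[OF assms(2)]
proof (induction rule: rtrancl_induct)
  case (step y z)
  then have c: "covers r z y" by simp
  then have "y \<in> P" "z \<in> P" using le_in by (auto simp: covers_def)
  then have "adj (\<kappa> y) (\<kappa> z)" using NA c by (auto simp: neighbors_def)
  then show ?case using step.IH S adj_sym by blast
qed simp

text \<open>By NA, relations of \<open>P\<close> never leave a set of colors closed under adjacency,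
  so a proper such set would split \<open>P\<close>.\<close>

lemma colors_connected:
  assumes conn: "connected_poset P r"
    and S: "S \<subseteq> \<Gamma>" "S \<noteq> {}" "\<And>a b. a \<in> S \<Longrightarrow> adj a b \<Longrightarrow> b \<in> S"
  shows "S = \<Gamma>"
proof (rule ccontr)
  assume ne: "S \<noteq> \<Gamma>"
  let ?A = "{x \<in> P. \<kappa> x \<in> S}" and ?B = "{x \<in> P. \<kappa> x \<notin> S}"
  obtain a where "a \<in> S" using S(2) by blast
  then have A: "?A \<noteq> {}" using color_class_nonempty[of a] S(1) by (auto simp: color_class_def)
  obtain b where "b \<in> \<Gamma>" "b \<notin> S" using S(1) ne by blast
  then have B: "?B \<noteq> {}" using color_class_nonempty[of b] by (auto simp: color_class_def)
  have no: "\<not> comparable r x y" if "x \<in> ?A" "y \<in> ?B" for x y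
    using that le_color_closed[of S x y] le_color_closed[of S y x] S(3)
    by (auto simp: comparable_def)
  have "?A \<inter> ?B = {}" "?A \<union> ?B = P" by auto
  with A B no have *: "?A \<noteq> {} \<and> ?B \<noteq> {} \<and> ?A \<inter> ?B = {} \<and> ?A \<union> ?B = P \<and>
    (\<forall>x\<in>?A. \<forall>y\<in>?B. \<not> comparable r x y)" by simp
  show False
    by (rule notE[OF conn[unfolded connected_poset_def]], rule exI[of _ ?A], rule exI[of _ ?B],
        rule *)
qed

text \<open>By AC, the elements of color \<open>b\<close> above a fixed one are comparable to
  \<open>x\<close>: those below \<open>x\<close> lie in a finite interval, those above in the set
  that UCB1 makes finite.\<close>

lemma bounded_adjacent:
  assumes ab: "adj a b" and x: "maximal_in (color_class a) x"
  shows "\<exists>t. maximal_in (color_class b) t"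
proof (rule ccontr)
  assume no: "\<nexists>t. maximal_in (color_class b) t"
  have ba: "a \<in> \<Gamma>" "b \<in> \<Gamma>" "adj b a" using adj_in[OF ab] ab adj_sym by blast+
  have fin: "finite (upper_adjacent x)" using UCB1[OF ba(1) x] by simp
  have xa: "x \<in> P" "\<kappa> x = a" using x by (auto simp: maximal_in_def color_class_def)
  have comp: "(z, x) \<in> r \<or> (x, z) \<in> r" if "z \<in> color_class b" for z
    using AC[of z x] that xa ba(3) by (auto simp: color_class_def comparable_def)
  obtain z0 where z0: "z0 \<in> color_class b" using color_class_nonempty[OF ba(2)] by blast
  let ?A = "{z \<in> color_class b. (z0, z) \<in> r}"
  have "?A \<subseteq> closed_interval r z0 x \<union> upper_adjacent x"
  proof
    fix z assume z: "z \<in> ?A"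
    have "z \<noteq> x" "adj (\<kappa> z) (\<kappa> x)" "z \<in> P" using z xa ba(3) by (auto simp: color_class_def)
    then show "z \<in> closed_interval r z0 x \<union> upper_adjacent x"
      using z comp[of z] by (auto simp: closed_interval_def upper_adjacent_def)
  qed
  then have finA: "finite ?A" using finite_subset finite_interval fin by blast
  moreover have "z0 \<in> ?A" using z0 le_refl by (auto simp: color_class_def)
  then have "?A \<noteq> {}" by blast
  ultimately obtain m where m: "m \<in> ?A" "\<And>z. z \<in> ?A \<Longrightarrow> (m, z) \<in> r \<Longrightarrow> z = m"
    using ex_maximal by blast
  have "maximal_in (color_class b) m" unfolding maximal_in_def
  proof (intro conjI ballI impI)
    show "m \<in> color_class b" using m(1) by simp
    fix z assume z: "z \<in> color_class b" "(m, z) \<in> r"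
    then have "(z0, z) \<in> r" using m(1) le_trans[of z0 m z] by simp
    then show "z = m" using m(2) z by simp
  qed
  then show False using no by blast
qed

text \<open>Having a maximum spreads along adjacency, so one maximum would give maxima everywhere,
  against \<open>bounded_imp_finite\<close>.\<close>

lemma infinite_imp_unbounded:
  assumes conn: "connected_poset P r" and inf: "infinite P"
  shows "\<not> maximal_in (color_class a) t"
proof
  assume t: "maximal_in (color_class a) t"
  let ?S = "{a \<in> \<Gamma>. \<exists>t. maximal_in (color_class a) t}"
  have aG: "a \<in> \<Gamma>" using t color_in by (auto simp: maximal_in_def color_class_def)
  have "?S = \<Gamma>"
  proof (rule colors_connected[OF conn])
    show "?S \<noteq> {}" using aG t by blast
    show "b \<in> ?S" if "a \<in> ?S" "adj a b" for a b
      using that bounded_adjacent[of a b] adj_in by blast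
  qed auto
  then have "finite P" by (intro bounded_imp_finite) blast
  then show False using inf by simp
qed

text \<open>Everything below a chosen element of some class is discarded. A class that is discarded
  entirely has a maximum, since its elements above any given one lie in finitely many finite
  intervals.\<close>

lemma ex_good_filter:
  shows "\<exists>F. good_filter \<Gamma> F"
proof -
  obtain y where y: "\<And>a. a \<in> \<Gamma> \<Longrightarrow> y a \<in> color_class a"
  proof -
    have "\<forall>a. \<exists>y. a \<in> \<Gamma> \<longrightarrow> y \<in> color_class a" using color_class_nonempty by blast
    from choice[OF this] show thesis using that by blast
  qed
  define F where "F = {z \<in> P. \<forall>a\<in>\<Gamma>. (z, y a) \<notin> r}"
  have "upset F" using le_in(2) by (auto simp: upset_def F_def dest: le_trans)
  moreover have "\<not> color_class a \<subseteq> F" if "a \<in> \<Gamma>" for a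
    using y[OF that] that le_refl[of "y a"] by (auto simp: F_def color_class_def)
  moreover have "\<exists>t. maximal_in (color_class a) t"
    if a: "a \<in> \<Gamma>" and e: "F \<inter> color_class a = {}" for a
  proof -
    obtain z0 where z0: "z0 \<in> color_class a" using color_class_nonempty[OF a] by blast
    let ?A = "{z \<in> color_class a. (z0, z) \<in> r}"
    have "?A \<subseteq> (\<Union>b\<in>\<Gamma>. closed_interval r z0 (y b))"
      using e by (auto simp: F_def closed_interval_def color_class_def)
    then have "finite ?A" by (rule finite_subset) (simp add: finite_colors finite_interval)
    moreover have "z0 \<in> ?A" using z0 le_refl by (auto simp: color_class_def)
    then have "?A \<noteq> {}" by blast
    ultimately obtain m where m: "m \<in> ?A" "\<And>z. z \<in> ?A \<Longrightarrow> (m, z) \<in> r \<Longrightarrow> z = m"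
      using ex_maximal by blast
    have "maximal_in (color_class a) m" unfolding maximal_in_def
    proof (intro conjI ballI impI)
      show "m \<in> color_class a" using m(1) by simp
      fix z assume z: "z \<in> color_class a" "(m, z) \<in> r"
      then have "(z0, z) \<in> r" using m(1) le_trans[of z0 m z] by simp
      then show "z = m" using m(2) z by simp
    qed
    then show ?thesis ..
  qed
  ultimately have "good_filter \<Gamma> F" by (auto simp: good_filter_def)
  then show ?thesis ..
qed

end

section \<open>Embedding into the heap of a periodic word\<close>

context heap_word
begin

definition pred_letter :: "int \<Rightarrow> int"
  where "pred_letter i = (SOME p. p < i \<and> c p = c i \<and> (\<forall>k. p < k \<and> k < i \<longrightarrow> c k \<noteq> c i))"

lemma pred_letter:
  "pred_letter i < i" "c (pred_letter i) = c i"
  "\<And>k. pred_letter i < k \<Longrightarrow> k < i \<Longrightarrow> c k \<noteq> c i"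
proof -
  obtain j where "j < i" "c j = c i" using letter_below[OF letter_in] by blast
  then obtain p where "p < i \<and> c p = c i \<and> (\<forall>k. p < k \<and> k < i \<longrightarrow> c k \<noteq> c i)"
    using ex_pred_int[of "\<lambda>k. c k = c i" j i] by metis
  then have "pred_letter i < i \<and> c (pred_letter i) = c i \<and>
      (\<forall>k. pred_letter i < k \<and> k < i \<longrightarrow> c k \<noteq> c i)"
    unfolding pred_letter_def by (rule someI)
  then show "pred_letter i < i" "c (pred_letter i) = c i"
    "\<And>k. pred_letter i < k \<Longrightarrow> k < i \<Longrightarrow> c k \<noteq> c i" by blast+
qed

lemma letter_pred_funpow: "c ((pred_letter ^^ n) i) = c i"
  by (induction n) (simp_all add: pred_letter)

end

context colored_d_complete
begin

lemma ex_word_tail: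
  assumes conn: "connected_poset P r" and inf: "infinite P"
  shows "\<exists>c F. \<exists>x :: nat \<Rightarrow> 'a. heap_word \<Gamma> \<theta> c \<and> upset F \<and> range x = F \<and>
    (\<forall>n. min_of (F - x ` {..<n}) (x n) \<and> \<kappa> (x n) = c (int n))"
proof -
  obtain F0 where F0: "good_filter \<Gamma> F0" using ex_good_filter by blast
  obtain a0 where a0: "a0 \<in> \<Gamma>" using inf surjective by fastforce
  have nonempty: "G \<noteq> {}" if "good_filter \<Gamma> G" for G
    using that a0 infinite_imp_unbounded[OF conn inf] by (auto simp: good_filter_def)
  define y where "y G = (SOME x. min_of G x)" for G
  have y: "min_of G (y G)" if "good_filter \<Gamma> G" for G
    unfolding y_def using ex_min_of[OF that nonempty[OF that]] by (rule someI_ex)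
  define H where "H = rec_nat F0 (\<lambda>_ G. G - {y G})"
  have H: "H 0 = F0" "\<And>n. H (Suc n) = H n - {y (H n)}" by (simp_all add: H_def)
  have good: "good_filter \<Gamma> (H n)" for n
    by (induction n) (simp_all add: H F0 good_filter_remove y)
  obtain i j where ij: "i < j" "\<And>a. a \<in> \<Gamma> \<Longrightarrow> weight (H i) a = weight (H j) a"
    using weight_pigeonhole[of \<Gamma> H, OF good] by blast
  define N d m where "N = j - i" and "d n = \<kappa> (y (H (i + n)))" and "m n = weight (H (i + n))" for n
  have N: "0 < N" using ij(1) by (simp add: N_def)
  have d: "d n \<in> \<Gamma>" "m n (d n) = - 1" for n
    using weight_of_min(1)[OF good y[OF good]] y[OF good, of "i + n"] good_filterD(1)[OF good, of "i + n"]
      color_in by (auto simp: d_def m_def min_of_def)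
  have step: "m (Suc n) a = m n a + \<theta> (d n) a" if "a \<in> \<Gamma>" for n a
    using weight_remove[OF good y[OF good] that, of "i + n"] by (simp add: d_def m_def H)
  have period: "m N a = m 0 a" if "a \<in> \<Gamma>" for a
    using ij that by (simp add: m_def N_def)
  obtain c M where w: "weighted_word \<Gamma> c M" and M0: "\<And>a. M 0 a = m 0 a"
    and cd: "\<And>n k. n < N \<Longrightarrow> c (int n + int N * k) = d n"
    by (rule ex_periodic_word[of N d \<Gamma> m, OF N d step period]) (assumption | rule that)+
  \<comment> \<open>Over a period the changes of the entry of \<open>a\<close> cancel. If
    \<open>a\<close> is not a letter, they all have the same sign and vanish, so no letter is
    adjacent to \<open>a\<close>.\<close>
  have all_colors: "d ` {..<N} = \<Gamma>"
  proof (rule colors_connected[OF conn])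
    show "d ` {..<N} \<subseteq> \<Gamma>" using d(1) by (simp add: image_subset_iff)
    show "d ` {..<N} \<noteq> {}" using N by auto
    fix b a assume b: "b \<in> d ` {..<N}" "adj b a"
    have a: "a \<in> \<Gamma>" by (rule adj_in(2)[OF b(2)])
    have telescope: "m k a = m 0 a + (\<Sum>n<k. \<theta> (d n) a)" for k
      by (induction k) (simp_all add: step[OF a])
    have sum0: "(\<Sum>n<N. - \<theta> (d n) a) = 0"
      using period[OF a] telescope[of N] by (simp add: sum_negf)
    show "a \<in> d ` {..<N}"
    proof (rule ccontr)
      assume na: "a \<notin> d ` {..<N}"
      have "0 \<le> - \<theta> (d n) a" if "n \<in> {..<N}" for n
        using theta_nonpos[OF d(1) a, of n] na that by auto
      then have "\<theta> (d n) a = 0" if "n \<in> {..<N}" for n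
        using sum_nonneg_0[OF _ _ sum0 that] by simp
      then show False using b by (auto simp: adj_def)
    qed
  qed
  have occurs: "\<exists>k>i. c k = a" "\<exists>k<i. c k = a" if "a \<in> \<Gamma>" for a i
  proof -
    have "a \<in> d ` {..<N}" using all_colors that by simp
    then obtain n where n: "n < N" "a = d n" by blast
    \<comment> \<open>As \<open>N\<close> is at least 1, \<open>\<bar>i\<bar> + 1\<close> periods
      lead past \<open>i\<close> on either side; downwards one more period absorbs
      \<open>n < N\<close>.\<close>
    have "i < int n + int N * (\<bar>i\<bar> + 1)" "int n + int N * (- \<bar>i\<bar> - 2) < i"
    proof -
      define q where "q = int N * (\<bar>i\<bar> + 1)"
      have "1 * (\<bar>i\<bar> + 1) \<le> q" unfolding q_def using N by (intro mult_right_mono) auto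
      then have q: "i < q" "- q < i" using abs_ge_self[of i] abs_ge_minus_self[of i] by auto
      moreover have "int N * (- \<bar>i\<bar> - 2) = - q - int N" by (simp add: q_def algebra_simps)
      ultimately show "i < int n + int N * (\<bar>i\<bar> + 1)" "int n + int N * (- \<bar>i\<bar> - 2) < i"
        using n(1) unfolding q_def[symmetric] by auto
    qed
    then show "\<exists>k>i. c k = a" "\<exists>k<i. c k = a" using cd[OF n(1)] n(2) by blast+
  qed
  have hw: "heap_word \<Gamma> \<theta> c"
  proof unfold_locales
    show "c i \<in> \<Gamma>" for i using w by (simp add: weighted_word_def)
    show "(\<Sum>k\<in>{i<..<j}. - \<theta> (c k) (c i)) = 2" if "i < j" "c j = c i" for i j
      by (rule weighted_word_gap[OF w subset_refl that])
  qed (use occurs in auto)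
  \<comment> \<open>The choices behind \<open>H\<close> need not repeat after stage
    \<open>j\<close>, so the periodic word is run afresh from \<open>H i\<close>, whose weight is
    \<open>M 0\<close>.\<close>
  define F where "F = H i"
  have F: "good_filter \<Gamma> F" using good by (simp add: F_def)
  have "weight F a = M 0 a" if "a \<in> \<Gamma>" for a by (simp add: F_def M0 m_def)
  from weighted_word_removal[OF F w this]
  obtain x :: "nat \<Rightarrow> 'a" where x: "\<And>n. min_of (F - x ` {..<n}) (x n)" "\<And>n. \<kappa> (x n) = c (int n)"
    by metis
  have xF: "x n \<in> F" for n using x(1)[of n] by (simp add: min_of_def)
  have inj: "inj x" using x(1) by (rule removal_inj)
  \<comment> \<open>An element never removed would lie above infinitely many removed elements of its
    own color, against \<open>finite_below\<close>.\<close>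
  have "range x = F"
  proof (rule ccontr)
    assume "range x \<noteq> F"
    then obtain z where z: "z \<in> F" "z \<notin> range x" using xF by blast
    have zP: "z \<in> P" using z(1) good_filterD(1)[OF F] by blast
    let ?S = "{n. c (int n) = \<kappa> z}"
    have "\<exists>n>k. n \<in> ?S" for k
    proof -
      obtain l where "int k < l" "c l = \<kappa> z" using occurs(1)[OF color_in[OF zP]] by blast
      then have "k < nat l \<and> nat l \<in> ?S" by simp
      then show ?thesis by blast
    qed
    then have "infinite ?S" unfolding finite_nat_set_iff_bounded by (meson less_asym)
    then have "infinite (x ` ?S)" using inj finite_imageD inj_on_subset by blast
    moreover have "x ` ?S \<subseteq> {w \<in> F. (w, z) \<in> r}"
    proof
      fix w assume "w \<in> x ` ?S"
      then obtain n where n: "w = x n" "c (int n) = \<kappa> z" by blast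
      have "(x n, z) \<in> r \<or> (z, x n) \<in> r"
        using color_class_chain[of "x n" "\<kappa> z" z] xF[of n] zP good_filterD(1)[OF F] x(2)[of n] n(2)
        by (auto simp: color_class_def)
      moreover have "(z, x n) \<notin> r" using x(1)[of n] z by (auto simp: min_of_def)
      ultimately show "w \<in> {w \<in> F. (w, z) \<in> r}" using n(1) xF by simp
    qed
    ultimately show False using finite_subset finite_below[OF F] by blast
  qed
  moreover have "upset F" by (rule good_filterD(2)[OF F])
  ultimately show ?thesis using hw x by (intro exI[of _ c] exI[of _ F] exI[of _ x]) simp
qed

end

section \<open>Positions of the elements of \<open>P\<close> in the word\<close>

locale word_tail = colored_d_complete \<Gamma> \<theta> P r \<kappa> + heap_word \<Gamma> \<theta> c
  for \<Gamma> :: "'c set" and \<theta> :: "'c \<Rightarrow> 'c \<Rightarrow> int"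
    and P :: "'a set" and r :: "'a rel" and \<kappa> :: "'a \<Rightarrow> 'c" and c :: "int \<Rightarrow> 'c" +
  fixes F :: "'a set" and x :: "nat \<Rightarrow> 'a"
  assumes unbounded: "\<not> maximal_in (color_class a) t"
    and upset_F: "upset F"
    and range_x: "range x = F"
    and removal: "min_of (F - x ` {..<n}) (x n)"
    and color_x: "\<kappa> (x n) = c (int n)"
begin

lemma inj_x: "inj x"
  using removal by (rule removal_inj)

lemma F_sub: "F \<subseteq> P"
  using upset_F by (simp add: upset_def)

lemma x_in: "x n \<in> F" "x n \<in> P"
  using range_x F_sub by auto

lemma x_not_above:
  assumes "m < n"
  shows "(x n, x m) \<notin> r"
proof
  assume "(x n, x m) \<in> r"
  moreover have "x n \<in> F - x ` {..<m}" using x_in(1) inj_eq[OF inj_x] assms by auto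
  ultimately have "x n = x m" using removal[of m] by (simp add: min_of_def)
  then show False using injD[OF inj_x] assms by auto
qed

text \<open>Outside \<open>F\<close>, occurrences of the color of \<open>y\<close> are counted down
  from its first nonnegative position. The count includes \<open>y\<close> itself, so the highest
  element of its color outside \<open>F\<close> gets the last negative occurrence.\<close>

definition position :: "'a \<Rightarrow> int"
  where "position y = (if y \<in> F then int (inv x y)
    else (pred_letter ^^ card {z \<in> P - F. \<kappa> z = \<kappa> y \<and> (y, z) \<in> r}) (int (LEAST n. c (int n) = \<kappa> y)))"

lemma position_x: "position (x n) = int n"
  using x_in inv_f_f[OF inj_x] by (simp add: position_def)

lemma ex_first:
  assumes "a \<in> \<Gamma>"
  shows "c (int (LEAST n. c (int n) = a)) = a"
proof -
  obtain j where "j > 0" "c j = a" using letter_above[OF assms, of 0] by blast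
  then have "c (int (nat j)) = a" by simp
  then show ?thesis by (rule LeastI)
qed

lemma color_position: "y \<in> P \<Longrightarrow> c (position y) = \<kappa> y"
proof (cases "y \<in> F")
  case True
  then obtain n where "y = x n" using range_x by blast
  then show ?thesis using position_x color_x by simp
next
  case False
  assume "y \<in> P"
  then show ?thesis using False ex_first[OF color_in] by (simp add: position_def letter_pred_funpow)
qed

text \<open>Every color occurs in the tail, and an element outside \<open>F\<close> lies below all
  elements of its color in \<open>F\<close>.\<close>

lemma finite_above_outside: "finite {z \<in> P - F. (y, z) \<in> r}"
proof -
  let ?f = "\<lambda>a. x (LEAST n. c (int n) = a)"
  have "{z \<in> P - F. (y, z) \<in> r} \<subseteq> (\<Union>a\<in>\<Gamma>. closed_interval r y (?f a))"
  proof
    fix z assume z: "z \<in> {z \<in> P - F. (y, z) \<in> r}"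
    let ?w = "?f (\<kappa> z)"
    have "\<kappa> ?w = \<kappa> z" using ex_first[OF color_in] z color_x by simp
    then have "(?w, z) \<in> r \<or> (z, ?w) \<in> r"
      using EC[of ?w z] x_in(2) z by (auto simp: comparable_def)
    then have "(z, ?w) \<in> r" using upsetD[OF upset_F x_in(1)] z by blast
    then show "z \<in> (\<Union>a\<in>\<Gamma>. closed_interval r y (?f a))"
      using z color_in by (auto simp: closed_interval_def)
  qed
  then show ?thesis by (rule finite_subset) (simp add: finite_colors finite_interval)
qed

text \<open>Turns the explicit count into a recursion: one step down in a class is one occurrence
  back in the word.\<close>

lemma position_previous:
  assumes cons: "consecutive a y z" and yF: "y \<notin> F"
  shows "position y = pred_letter (position z)"
proof -
  have yz: "y \<in> P" "z \<in> P" "\<kappa> y = a" "\<kappa> z = a" "(y, z) \<in> r" "y \<noteq> z"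
    using cons by (auto simp: consecutive_def color_class_def)
  have above_y: "(z, w) \<in> r" if w: "w \<in> P" "\<kappa> w = a" "(y, w) \<in> r" "w \<noteq> y" for w
  proof (rule ccontr)
    assume n: "(z, w) \<notin> r"
    then have "(w, z) \<in> r" "w \<noteq> z"
      using color_class_chain[of w a z] w yz le_refl by (auto simp: color_class_def)
    then have "w \<in> open_interval r y z" using w by (auto simp: open_interval_def closed_interval_def)
    then show False using cons w by (auto simp: consecutive_def color_class_def)
  qed
  let ?K = "\<lambda>y. {w \<in> P - F. \<kappa> w = \<kappa> y \<and> (y, w) \<in> r}"
  have fin: "finite (?K z)" by (rule finite_subset[OF _ finite_above_outside[of z]]) auto
  show ?thesis
  proof (cases "z \<in> F")
    case True
    then obtain n where n: "z = x n" using range_x by blast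
    \<comment> \<open>An earlier \<open>x k\<close> of this color would lie above \<open>y\<close>
      but not above \<open>z\<close>, against consecutiveness.\<close>
    have "(LEAST n. c (int n) = a) = n"
    proof (rule Least_equality)
      show "c (int n) = a" using color_x[of n] n yz by simp
      fix k assume k: "c (int k) = a"
      show "n \<le> k"
      proof (rule ccontr)
        assume "\<not> n \<le> k"
        then have "(z, x k) \<notin> r" using x_not_above n by simp
        moreover have "(y, x k) \<in> r"
          using color_class_chain[of y a "x k"] yz x_in[of k] color_x[of k] k yF
            upsetD[OF upset_F x_in(1)] by (auto simp: color_class_def)
        moreover have "x k \<noteq> y" using x_in(1) yF by blast
        ultimately show False using above_y x_in(2) color_x k by auto
      qed
    qed
    moreover have "?K y = {y}"
    proof
      have "w = y" if "w \<in> ?K y" for w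
        using above_y[of w] that yz upsetD[OF upset_F True, of w] by auto
      then show "?K y \<subseteq> {y}" by blast
    qed (use yz yF le_refl in auto)
    ultimately show ?thesis using yF n position_x yz by (simp add: position_def)
  next
    case False
    have "?K y = insert y (?K z)"
    proof
      show "?K y \<subseteq> insert y (?K z)" using above_y yz by auto
      show "insert y (?K z) \<subseteq> ?K y" using yz yF le_refl le_trans[OF yz(5)] by auto
    qed
    moreover have "y \<notin> ?K z" using yz le_antisym by blast
    ultimately have "card (?K y) = Suc (card (?K z))" using fin by simp
    then show ?thesis using yF False yz by (simp add: position_def)
  qed
qed

text \<open>Extending a filter downwards by one element \<open>y\<close>: the elements of adjacent colors between
  \<open>y\<close> and the next element of its color, and the letters of adjacent colors between their
  positions, contribute the same sum \<open>2\<close>, so the positions of the former are all of the latter.\<close>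

lemma position_filter:
  assumes G: "upset G" "F \<subseteq> G" "finite (G - F)"
  shows "(\<forall>u\<in>G. \<forall>v\<in>G. \<kappa> u = \<kappa> v \<or> adj (\<kappa> u) (\<kappa> v) \<longrightarrow> ((u, v) \<in> r \<longleftrightarrow> position u \<le> position v)) \<and>
    (\<forall>u\<in>G. \<forall>k. (position u, k) \<in> step_rel \<longrightarrow> k \<in> position ` G)"
  using assms
proof (induction "card (G - F)" arbitrary: G rule: less_induct)
  case less
  show ?case
  proof (cases "G - F = {}")
    case True
    then have GF: "G = F" using less.prems by blast
    have "(x i, x j) \<in> r \<longleftrightarrow> i \<le> j" if "\<kappa> (x i) = \<kappa> (x j) \<or> adj (\<kappa> (x i)) (\<kappa> (x j))" for i j
    proof -
      have cmp: "(x i, x j) \<in> r \<or> (x j, x i) \<in> r"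
        using that EC[of "x i" "x j"] AC[of "x i" "x j"] x_in(2) by (auto simp: comparable_def)
      show ?thesis
      proof (cases i j rule: linorder_cases)
        case equal
        then show ?thesis using le_refl x_in(2) by simp
      qed (use cmp x_not_above in auto)
    qed
    moreover have "k \<in> position ` F" if "(position (x i), k) \<in> step_rel" for i k
    proof -
      have "0 \<le> k" using that by (auto simp: step_rel_def position_x)
      then have "k = position (x (nat k))" by (simp add: position_x)
      then show ?thesis using x_in(1) by blast
    qed
    moreover have "\<exists>i. u = x i" if "u \<in> F" for u using that range_x by blast
    ultimately show ?thesis
      unfolding GF by (metis of_nat_le_iff position_x)
  next
    case False
    obtain y where y: "y \<in> G - F" "\<And>z. z \<in> G - F \<Longrightarrow> (z, y) \<in> r \<Longrightarrow> z = y"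
      using ex_minimal[OF less.prems(3) False] by blast
    have GP: "G \<subseteq> P" using less.prems(1) by (simp add: upset_def)
    have yP: "y \<in> P" using y GP by blast
    have y_min: "z = y" if "z \<in> G" "(z, y) \<in> r" for z
      using y(2)[of z] that upsetD[OF upset_F, of z y] y(1) by blast
    let ?G = "G - {y}"
    have up: "\<And>u v. u \<in> G \<Longrightarrow> (u, v) \<in> r \<Longrightarrow> v \<in> G" using upsetD[OF less.prems(1)] .
    have "upset ?G" using up y_min GP unfolding upset_def by blast
    moreover have "F \<subseteq> ?G" using less.prems(2) y by blast
    moreover have "card (?G - F) < card (G - F)"
      using less.prems(3) y(1) by (intro psubset_card_mono) auto
    moreover have "finite (?G - F)" using less.prems(3) by (rule finite_subset[rotated]) auto
    ultimately have IH: "(\<forall>u\<in>?G. \<forall>v\<in>?G. \<kappa> u = \<kappa> v \<or> adj (\<kappa> u) (\<kappa> v) \<longrightarrow> ((u, v) \<in> r \<longleftrightarrow> position u \<le> position v)) \<and>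
    (\<forall>u\<in>?G. \<forall>k. (position u, k) \<in> step_rel \<longrightarrow> k \<in> position ` ?G)"
      using less.hyps[of ?G] by simp
    have order: "(u, v) \<in> r \<longleftrightarrow> position u \<le> position v"
      if "u \<in> ?G" "v \<in> ?G" "\<kappa> u = \<kappa> v \<or> adj (\<kappa> u) (\<kappa> v)" for u v
      using IH that by blast
    have up_image: "k \<in> position ` ?G" if "u \<in> ?G" "(position u, k) \<in> step_rel" for u k
      using IH that by blast
    define a where "a = \<kappa> y"
    have aG: "a \<in> \<Gamma>" using color_in yP by (simp add: a_def)
    have ya: "y \<in> color_class a" using yP by (simp add: a_def color_class_def)
    \<comment> \<open>Absence of maxima provides the upper end of the interval to which ICE2 is
      applied.\<close>
    obtain w where "w \<in> color_class a" "(y, w) \<in> r" "w \<noteq> y"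
      using unbounded[of a y] ya by (auto simp: maximal_in_def)
    then obtain z where cons: "consecutive a y z" using ex_next[OF ya] by metis
    have z: "(y, z) \<in> r" "y \<noteq> z" "z \<in> P" "\<kappa> z = a" "\<kappa> y = a" "z \<in> ?G"
      using cons up y(1) by (auto simp: consecutive_def color_class_def)
    have pos: "position y = pred_letter (position z)"
      using position_previous[OF cons] y(1) by blast
    have cz: "c (position z) = a" "c (position y) = a" using color_position z yP by auto
    have lt: "position y < position z"
      and gap: "\<And>k. position y < k \<Longrightarrow> k < position z \<Longrightarrow> c k \<noteq> a"
      using pred_letter[of "position z"] cz unfolding pos by auto
    have above: "(y, u) \<in> r" if "u \<in> G" "\<kappa> u = a \<or> adj (\<kappa> u) a" for u
    proof -
      have "(u, y) \<in> r \<or> (y, u) \<in> r"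
        using EC[of u y] AC[of u y] that GP yP z(5) by (auto simp: comparable_def)
      then show ?thesis using y_min[OF that(1)] le_refl yP by blast
    qed
    have above_z: "(z, u) \<in> r" if u: "u \<in> ?G" "\<kappa> u = a" for u
    proof (rule ccontr)
      assume "(z, u) \<notin> r"
      then have "(u, z) \<in> r" "u \<noteq> z"
        using color_class_chain[of u a z] u z le_refl GP by (auto simp: color_class_def)
      then have "u \<in> open_interval r y z"
        using above[of u] u by (auto simp: open_interval_def closed_interval_def)
      then show False using cons u GP by (auto simp: consecutive_def color_class_def)
    qed
    \<comment> \<open>This is what the second invariant is for. If \<open>u\<close> of adjacent
      color had a position at most that of \<open>y\<close>, closure under \<open>step_rel\<close>
      would put some \<open>v\<close> of \<open>?G\<close> of color \<open>a\<close> at that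
      position; but \<open>v\<close> is at least \<open>z\<close> in \<open>P\<close>, hence also in
      position.\<close>
    have pos_above: "position y < position u" if u: "u \<in> ?G" "\<kappa> u = a \<or> adj (\<kappa> u) a" for u
    proof (cases "\<kappa> u = a")
      case True
      then have "position z \<le> position u" using order[OF z(6) u(1)] above_z[OF u(1)] z(4) by simp
      then show ?thesis using lt by simp
    next
      case nu: False
      then have adj: "adj (\<kappa> u) a" using u(2) by blast
      have uP: "u \<in> P" using u(1) GP by blast
      show ?thesis
      proof (rule ccontr)
        assume "\<not> position y < position u"
        then have "(position u, position y) \<in> step_rel"
          using adj color_position[OF uP] cz by (simp add: step_rel_def)
        then obtain v where v: "v \<in> ?G" "position v = position y" using up_image[OF u(1)] by force
        then have "\<kappa> v = a" using color_position[of v] cz(2) GP by auto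
        then have "position z \<le> position v" using order[OF z(6) v(1)] above_z[OF v(1)] z(4) by simp
        then show False using lt v by simp
      qed
    qed
    let ?A = "{u \<in> open_interval r y z. adj (\<kappa> u) a}"
    let ?B = "{k. position y < k \<and> k < position z \<and> adj (c k) a}"
    have A_G: "u \<in> ?G" if "u \<in> ?A" for u
      using that up y(1) by (auto simp: open_interval_def closed_interval_def)
    have finA: "finite ?A" using finite_open_interval by simp
    have finB: "finite ?B" by (rule finite_subset[of _ "{position y..position z}"]) auto
    have inj: "inj_on position ?A"
    proof (rule inj_onI)
      fix u v assume uv: "u \<in> ?A" "v \<in> ?A" "position u = position v"
      have G: "u \<in> ?G" "v \<in> ?G" using A_G uv by blast+
      then have "u \<in> P" "v \<in> P" using GP by blast+
      then have "\<kappa> u = \<kappa> v" using color_position uv(3) by metis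
      then show "u = v" using order[OF G] order[OF G(2,1)] uv(3) le_antisym by simp
    qed
    have A_B: "position ` ?A \<subseteq> ?B"
    proof
      fix k assume "k \<in> position ` ?A"
      then obtain u where u: "u \<in> ?A" "k = position u" by blast
      have uG: "u \<in> ?G" and adj: "adj (\<kappa> u) a" using A_G u(1) by auto
      have "c k = \<kappa> u" using color_position[of u] u(2) uG GP by auto
      moreover have "\<not> position z \<le> position u"
      proof
        assume "position z \<le> position u"
        then have "(z, u) \<in> r" using order[OF z(6) uG] adj z(4) adj_sym by blast
        then show False using u(1) le_antisym by (auto simp: open_interval_def closed_interval_def)
      qed
      ultimately show "k \<in> ?B" using pos_above[OF uG] adj u(2) by simp
    qed
    have "(\<Sum>u\<in>?A. - \<theta> (\<kappa> u) a) = (\<Sum>u\<in>open_interval r y z. - \<theta> (\<kappa> u) a)"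
    proof (rule sum.mono_neutral_left)
      show "\<forall>u\<in>open_interval r y z - ?A. - \<theta> (\<kappa> u) a = 0"
      proof
        fix u assume u: "u \<in> open_interval r y z - ?A"
        then have "u \<in> P" using le_in by (auto simp: open_interval_def closed_interval_def)
        moreover have "\<kappa> u \<noteq> a"
          using u cons \<open>u \<in> P\<close> by (auto simp: consecutive_def color_class_def)
        ultimately show "- \<theta> (\<kappa> u) a = 0" using theta_nonadj[OF color_in aG] u by simp
      qed
    qed (auto simp: finite_open_interval)
    also have "\<dots> = 2" by (rule ICE2[OF aG cons])
    finally have "(\<Sum>u\<in>?A. - \<theta> (\<kappa> u) a) = 2" .
    moreover have "- \<theta> (c (position u)) a = - \<theta> (\<kappa> u) a" if "u \<in> ?A" for u
      using color_position[of u] A_G[OF that] GP by auto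
    ultimately have "(\<Sum>u\<in>?A. - \<theta> (c (position u)) a) = 2" by simp
    then have "(\<Sum>k\<in>position ` ?A. - \<theta> (c k) a) = 2" 
      using sum.reindex[OF inj, of "\<lambda>k. - \<theta> (c k) a"] by (simp only: o_def)
    moreover have "(\<Sum>k\<in>?B. - \<theta> (c k) a) = 2"
      using gap_sum_adj[OF lt] cz gap by simp
    ultimately have "(\<Sum>k\<in>?B - position ` ?A. - \<theta> (c k) a) = 0"
      using sum_diff[OF finB A_B, of "\<lambda>k. - \<theta> (c k) a"] by simp
    then have zero: "- \<theta> (c k) a = 0" if "k \<in> ?B - position ` ?A" for k
      using sum_nonneg_0[of "?B - position ` ?A" "\<lambda>k. - \<theta> (c k) a" k] that finB
      by (auto simp: adj_def)
    have B_A: "?B \<subseteq> position ` ?A"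
    proof
      fix k assume k: "k \<in> ?B"
      show "k \<in> position ` ?A"
      proof (rule ccontr)
        assume "k \<notin> position ` ?A"
        then have "- \<theta> (c k) a = 0" using zero[of k] k by blast
        then show False using k by (simp add: adj_def)
      qed
    qed
    have order_G: "(u, v) \<in> r \<longleftrightarrow> position u \<le> position v"
      if uv: "u \<in> G" "v \<in> G" "\<kappa> u = \<kappa> v \<or> adj (\<kappa> u) (\<kappa> v)" for u v
    proof -
      consider "u = y" "v = y" | "u \<noteq> y" "v \<noteq> y" | "u = y" "v \<noteq> y" | "u \<noteq> y" "v = y" by blast
      then show ?thesis
      proof cases
        case 1
        then show ?thesis using le_refl yP by simp
      next
        case 2
        then show ?thesis using order uv by blast
      next
        case 3
        then have "\<kappa> v = a \<or> adj (\<kappa> v) a" using uv(3) z(5) adj_sym by metis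
        then show ?thesis using above[OF uv(2)] pos_above[of v] uv(2) 3 by simp
      next
        case 4
        then have "\<kappa> u = a \<or> adj (\<kappa> u) a" using uv(3) z(5) by metis
        then show ?thesis using y_min[OF uv(1)] pos_above[of u] uv(1) 4 by auto
      qed
    qed
    \<comment> \<open>Steps from \<open>y\<close> to \<open>position z\<close> or beyond are also
      steps from \<open>z\<close>; those ending before it hit \<open>?B\<close>, which is
      filled.\<close>
    have image_G: "k \<in> position ` G" if u: "u \<in> G" and k: "(position u, k) \<in> step_rel" for u k
    proof (cases "u = y")
      case False
      then show ?thesis using up_image[of u k] u k by blast
    next
      case True
      have ck: "position y \<le> k" "c k = a \<or> adj (c k) a"
        using k True cz adj_sym by (auto simp: step_rel_def)
      consider "k = position y" | "position z \<le> k" | "position y < k" "k < position z"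
        using ck(1) by linarith
      then show ?thesis
      proof cases
        case 1
        then show ?thesis using y(1) by blast
      next
        case 2
        then have "(position z, k) \<in> step_rel"
          using ck(2) cz adj_sym by (auto simp: step_rel_def)
        then show ?thesis using up_image[OF z(6)] by blast
      next
        case 3
        then have "k \<in> ?B" using gap ck(2) by blast
        then show ?thesis using B_A A_G by blast
      qed
    qed
    show ?thesis using order_G image_G by blast
  qed
qed

text \<open>\<open>P - F\<close> may be infinite, so statements about \<open>P\<close> are reached
  through filters that exceed \<open>F\<close> by finitely many elements.\<close>

lemma principal_extension:
  assumes "u \<in> P" "v \<in> P"
  obtains G where "upset G" "F \<subseteq> G" "finite (G - F)" "u \<in> G" "v \<in> G"
proof -
  let ?G = "F \<union> {z. (u, z) \<in> r} \<union> {z. (v, z) \<in> r}"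
  have "upset ?G"
    using upset_F le_in(2) by (auto simp: upset_def intro: le_trans)
  moreover have "?G - F \<subseteq> {z \<in> P - F. (u, z) \<in> r} \<union> {z \<in> P - F. (v, z) \<in> r}"
    using le_in(2) by blast
  then have "finite (?G - F)" using finite_subset finite_above_outside by blast
  ultimately show thesis using that[of ?G] assms le_refl by blast
qed

lemma position_order:
  assumes "u \<in> P" "v \<in> P" "\<kappa> u = \<kappa> v \<or> adj (\<kappa> u) (\<kappa> v)"
  shows "(u, v) \<in> r \<longleftrightarrow> position u \<le> position v"
proof -
  obtain G where "upset G" "F \<subseteq> G" "finite (G - F)" "u \<in> G" "v \<in> G"
    using principal_extension[OF assms(1,2)] .
  then show ?thesis using position_filter[of G] assms(3) by blast
qed

lemma position_up_closed:
  assumes u: "u \<in> P" and "(position u, k) \<in> step_rel"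
  obtains v where "v \<in> P" "position v = k"
proof -
  obtain G where G: "upset G" "F \<subseteq> G" "finite (G - F)" "u \<in> G"
    using principal_extension[OF u u] .
  then have "k \<in> position ` G" using position_filter[of G] assms(2) by blast
  then show thesis using that G(1) by (auto simp: upset_def)
qed

lemma inj_position: "inj_on position P"
proof (rule inj_onI)
  fix u v assume uv: "u \<in> P" "v \<in> P" "position u = position v"
  then have "\<kappa> u = \<kappa> v" using color_position by metis
  then show "u = v" using position_order[of u v] position_order[of v u] uv le_antisym by simp
qed

text \<open>Each generating step of the heap that starts at an element of \<open>P\<close> is
  realized in \<open>P\<close>. This gives both the reflection of the order and the filter
  property.\<close>

lemma heap_le_position:
  assumes "u \<in> P" "(position u, k) \<in> heap_le"
  shows "\<exists>v\<in>P. position v = k \<and> (u, v) \<in> r"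
  using assms(2) unfolding heap_le_def
proof (induction rule: rtrancl_induct)
  case base
  then show ?case using assms(1) le_refl by blast
next
  case (step j k)
  then obtain v where v: "v \<in> P" "position v = j" "(u, v) \<in> r" by blast
  then obtain w where w: "w \<in> P" "position w = k" using position_up_closed step.hyps(2) by blast
  have "\<kappa> v = \<kappa> w \<or> adj (\<kappa> v) (\<kappa> w)" "position v \<le> position w"
    using step.hyps(2) v w color_position by (auto simp: step_rel_def)
  then have "(v, w) \<in> r" using position_order v(1) w(1) by blast
  then show ?case using w v(3) le_trans by blast
qed

text \<open>By NA, covers in \<open>P\<close> join adjacent colors and so become generating steps of
  the heap.\<close>

lemma position_heap_le:
  assumes "(u, v) \<in> r"
  shows "(position u, position v) \<in> heap_le"
  using le_imp_cover_chain[OF assms]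
proof (induction rule: rtrancl_induct)
  case (step v w)
  then have c: "covers r w v" by simp
  then have vw: "v \<in> P" "w \<in> P" "(v, w) \<in> r" using le_in by (auto simp: covers_def)
  have adj: "adj (\<kappa> v) (\<kappa> w)" using NA[OF vw(1,2)] c by (auto simp: neighbors_def)
  then have "(position v, position w) \<in> heap_le"
    using position_order[OF vw(1,2)] vw color_position by (intro heap_le_step) auto
  then show ?case using step.IH heap_le_trans by blast
qed (rule heap_le_refl)

lemma filter_of_word_heap:
  assumes e: "inj e"
  shows "poset_filter (e ` position ` P) (range e) (heap_order e)"
    and "colored_iso (e \<circ> position) P r \<kappa> (e ` position ` P)
      (Restr (heap_order e) (e ` position ` P)) (c \<circ> inv e)"
proof -
  have iff: "(u, v) \<in> r \<longleftrightarrow> (position u, position v) \<in> heap_le" if uv: "u \<in> P" "v \<in> P" for u v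
  proof
    assume "(position u, position v) \<in> heap_le"
    then obtain w where "w \<in> P" "position w = position v" "(u, w) \<in> r"
      using heap_le_position[OF uv(1)] by blast
    then show "(u, v) \<in> r" using inj_onD[OF inj_position] uv(2) by blast
  qed (rule position_heap_le)
  show "poset_filter (e ` position ` P) (range e) (heap_order e)"
    unfolding poset_filter_def
  proof (intro conjI ballI impI)
    fix p q assume "p \<in> e ` position ` P" "q \<in> range e" "(p, q) \<in> heap_order e"
    then obtain u k where uk: "u \<in> P" "p = e (position u)" "q = e k" "(position u, k) \<in> heap_le"
      using heap_order_iff[OF e] by auto
    then show "q \<in> e ` position ` P" using heap_le_position by blast
  qed auto
  have "inj_on (e \<circ> position) P"
    using inj_position e by (intro comp_inj_on) (auto intro: inj_on_subset)
  then have "bij_betw (e \<circ> position) P (e ` position ` P)"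
    by (simp add: bij_betw_def image_comp)
  then show "colored_iso (e \<circ> position) P r \<kappa> (e ` position ` P)
      (Restr (heap_order e) (e ` position ` P)) (c \<circ> inv e)"
    using iff heap_order_iff[OF e] color_position inv_f_f[OF e] by (auto simp: colored_iso_def)
qed

end

lemma ex_inj_int:
  assumes "infinite (UNIV :: 'q set)"
  shows "\<exists>e :: int \<Rightarrow> 'q. inj e"
proof -
  obtain f :: "nat \<Rightarrow> 'q" where "inj f" using infinite_countable_subset[OF assms] by blast
  then have "inj (f \<circ> int_encode)" using inj_int_encode by (rule inj_compose)
  then show ?thesis by (rule exI[of _ "f \<circ> int_encode"])
qed

theorem theorem5p7:
  fixes \<Gamma> :: "'c set" and \<theta> :: "'c \<Rightarrow> 'c \<Rightarrow> int"
    and P :: "'a set" and r :: "'a rel" and \<kappa> :: "'a \<Rightarrow> 'c"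
  assumes "colored_poset \<Gamma> \<theta> P r \<kappa>"
    and "connected_poset P r"
    and "infinite P"
    and "infinite (UNIV :: 'q set)"
  shows "colored_d_complete \<Gamma> \<theta> P r \<kappa> \<longleftrightarrow>
    filter_of_connected_full_heap TYPE('q) \<Gamma> \<theta> P r \<kappa>"
proof
  assume "filter_of_connected_full_heap TYPE('q) \<Gamma> \<theta> P r \<kappa>"
  then show "colored_d_complete \<Gamma> \<theta> P r \<kappa>"
    using filter_of_full_heap_d_complete[OF assms(1)]
    by (auto simp: filter_of_connected_full_heap_def)
next
  assume d: "colored_d_complete \<Gamma> \<theta> P r \<kappa>"
  interpret colored_d_complete \<Gamma> \<theta> P r \<kappa> by (rule d)
  obtain c F and x :: "nat \<Rightarrow> 'a" where w: "heap_word \<Gamma> \<theta> c" "upset F" "range x = F"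
    "\<And>n. min_of (F - x ` {..<n}) (x n)" "\<And>n. \<kappa> (x n) = c (int n)"
    using ex_word_tail[OF assms(2,3)] by metis
  interpret word_tail \<Gamma> \<theta> P r \<kappa> c F x
    using infinite_imp_unbounded[OF assms(2,3)] w
    by (intro word_tail.intro word_tail_axioms.intro d) auto
  obtain e :: "int \<Rightarrow> 'q" where e: "inj e" using ex_inj_int[OF assms(4)] by blast
  have "connected_poset (range e) (heap_order e)"
    using connected_heap_word[OF e] colors_connected[OF assms(2)] by blast
  then show "filter_of_connected_full_heap TYPE('q) \<Gamma> \<theta> P r \<kappa>"
    unfolding filter_of_connected_full_heap_def
    using full_heap_word[OF e] filter_of_word_heap[OF e] by blast
qed

end
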